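(* Let $P(z),q(z)\in\mathbb{C}[z]$, $q\neq 0$, $a,b\in\mathbb{C}$, $a\neq b$, and let $Q(z)=\int q(z)\,dz$. Suppose that at least one of the points $a$ and $b$ is not a critical point of $P$. Then the following two conditions are equivalent: (i) $\int_a^b P^i(z)q(z)\,dz=0$ for all integers $i\ge 0$; (ii) there exist polynomials $\tilde P,\tilde Q,W\in\mathbb{C}[z]$ such that $P(z)=\tilde P(W(z))$, $Q(z)=\tilde Q(W(z))$ and $W(a)=W(b)$.
   Context: $Q$ denotes any antiderivative of $q$ (condition (ii) does not depend on the choice of constant). *)

theory Defs
  imports "HOL-Complex_Analysis.Complex_Analysis" "HOL-Computational_Algebra.Polynomial"
begin

end

theory Submission
  imports Defs
    "HOL-Computational_Algebra.Fundamental_Theorem_Algebra"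
    "HOL-Computational_Algebra.Polynomial_Factorial"
    "HOL-Computational_Algebra.Field_as_Ring"
begin

text \<open>
  Let \<open>a\<close> be the non-critical endpoint and normalise \<open>Q(a) = Q(b) = 0\<close>. If all moments vanish, then
  so does \<open>\<integral> Q P' / (P - t)\<close> for large \<open>t\<close>. By partial fractions this is a relation
  \<open>\<Sum> Q(p\<^sub>r) log ((b - p\<^sub>r) / (a - p\<^sub>r)) + \<Theta>(p\<^sub>r) = 0\<close> between the branches \<open>p\<^sub>r\<close> of \<open>P\<^sup>-\<^sup>1(t)\<close>. Continue it
  along a sector to a neighbourhood of \<open>\<alpha> = P(a)\<close> and let \<open>t\<close> turn around \<open>\<alpha>\<close>: the increments of the
  logarithms give \<open>Q(p\<^sub>s\<^sub>0) = \<Sum> c\<^sub>r Q(p\<^sub>r)\<close>, where \<open>p\<^sub>s\<^sub>0\<close> is the only branch tending to \<open>a\<close> and \<open>c\<^sub>r \<ge> 0\<close> is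
  non-zero only for branches tending to \<open>b\<close>. The weights add up to \<open>1\<close> if \<open>P(b) = \<alpha>\<close> and to \<open>0\<close>
  otherwise, which would force \<open>Q = 0\<close>. The monodromy at infinity is transitive, so the relation may be
  used at a branch where \<open>|Q|\<close> is maximal, and strict convexity yields \<open>Q(p\<^sub>s) = Q(p\<^sub>s\<^sub>0)\<close> for some
  \<open>p\<^sub>s\<close> tending to \<open>b\<close>. Finally, by Lueroth's theorem for polynomials, \<open>P\<close> and \<open>Q\<close> are polynomials in some \<open>W\<close>
  that is a rational function of \<open>P\<close> and \<open>Q\<close>; hence \<open>W(p\<^sub>s) = W(p\<^sub>s\<^sub>0)\<close>, and in the limit \<open>W(a) = W(b)\<close>.
\<close>

subsection \<open>Polynomials with a common right factor\<close>

lemma bezout_dvd_poly: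
  fixes F1 F2 :: "'a :: {factorial_ring_gcd, semiring_gcd_mult_normalize} poly"
  assumes "F1 \<noteq> 0"
  obtains \<Phi> D U V where "\<Phi> dvd F1" "\<Phi> dvd F2" "D \<noteq> 0" "smult D \<Phi> = U * F1 + V * F2"
proof -
  define I where "I = {G. G \<noteq> 0 \<and> (\<exists>U V. G = U * F1 + V * F2)}"
  have "F1 \<in> I"
    unfolding I_def using assms by (intro CollectI conjI exI[of _ 1] exI[of _ 0]) auto
  then obtain G where G: "G \<in> I" and Gmin: "\<And>H. H \<in> I \<Longrightarrow> degree G \<le> degree H"
    using ex_has_least_nat[of "\<lambda>G. G \<in> I" F1 degree] by blast
  from G obtain U V where G0: "G \<noteq> 0" and UV: "G = U * F1 + V * F2"
    unfolding I_def by blast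
  have dvd: "primitive_part G dvd F" if F: "F = s * F1 + t * F2" for F s t
  proof -
    obtain c q where c: "c \<noteq> 0" and eq: "smult c F = G * q + pseudo_mod F G"
      using pseudo_mod(1)[OF G0] by blast
    have "pseudo_mod F G = smult c F - G * q" using eq by simp
    also have "\<dots> = ([:c:] * s - U * q) * F1 + ([:c:] * t - V * q) * F2"
      by (simp add: F UV algebra_simps smult_add_right)
    finally have r: "pseudo_mod F G = ([:c:] * s - U * q) * F1 + ([:c:] * t - V * q) * F2" .
    have "pseudo_mod F G = 0"
    proof (rule ccontr)
      assume nz: "pseudo_mod F G \<noteq> 0"
      then have "pseudo_mod F G \<in> I" unfolding I_def using r by blast
      then show False using Gmin degree_pseudo_mod_less[OF G0 nz] by fastforce
    qed
    then have "G dvd smult c F" using eq by simp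
    then have "primitive_part G dvd primitive_part (smult c F)"
      by (rule primitive_part_dvd_primitive_partI)
    then obtain H where H: "smult (unit_factor c) (primitive_part F) = primitive_part G * H"
      unfolding primitive_part_smult by (elim dvdE)
    have "is_unit (unit_factor c)" using c by simp
    then obtain d where d: "d * unit_factor c = 1" by (metis dvd_def mult.commute)
    have "primitive_part F = smult (d * unit_factor c) (primitive_part F)" using d by simp
    also have "\<dots> = smult d (primitive_part G * H)" unfolding H[symmetric] by simp
    also have "\<dots> = primitive_part G * smult d H" by simp
    finally have "F = primitive_part G * smult (content F) (smult d H)"
      using content_times_primitive_part[of F] by (metis mult_smult_right)
    then show ?thesis by (rule dvdI)
  qed
  show ?thesis
  proof
    show "primitive_part G dvd F1" by (rule dvd[of _ 1 0]) simp
    show "primitive_part G dvd F2" by (rule dvd[of _ 0 1]) simp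
    show "content G \<noteq> 0" using G0 by simp
    show "smult (content G) (primitive_part G) = U * F1 + V * F2" using UV by simp
  qed
qed

text \<open>A bivariate \<open>G\<close> may be evaluated in its outer variable first (at the
  constant polynomial \<open>[:y:]\<close>) or have its coefficients specialised at \<open>x\<close>
  first; the order does not matter.\<close>

lemma poly_map_poly_eval:
  "poly (map_poly (\<lambda>c. poly c x) G) y = poly (poly G [:y:]) (x :: 'a :: comm_ring_1)"
  by (induction G) (auto simp: map_poly_pCons)

lemma coeff_poly_const:
  "coeff (poly G [:y:]) m = poly (map_poly (\<lambda>c. coeff c m) G) (y :: 'a :: comm_ring_1)"
  by (induction G) (auto simp: map_poly_pCons)

lemma poly_map_const_poly:
  "poly (poly (map_poly (\<lambda>c. [:c:]) P) [:y:]) x = poly P (y :: 'a :: comm_ring_1)"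
  by (induction P) (auto simp: map_poly_pCons)

section \<open>Square-free polynomials and fibres of constant size\<close>

lemma rsquarefree_dvd:
  assumes "p dvd q" "rsquarefree (q :: complex poly)"
  shows "rsquarefree p"
  using assms by (auto simp: rsquarefree_roots pderiv_mult elim!: dvdE)

lemma card_roots_rsquarefree:
  assumes "rsquarefree (p :: complex poly)"
  shows "card {z. poly p z = 0} = degree p"
proof -
  have p0: "p \<noteq> 0" using assms by (auto simp: rsquarefree_def)
  have "degree p = degree (smult (lead_coeff p) (\<Prod>z|poly p z = 0. [:-z, 1:]))"
    by (subst complex_poly_decompose_rsquarefree[OF assms]) simp
  also have "\<dots> = card {z. poly p z = 0}"
    using p0 by (simp add: degree_prod_eq_sum_degree)
  finally show ?thesis by simp
qed

lemma rsquarefree_diff_const: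
  fixes P :: "complex poly"
  assumes "t \<notin> poly P ` {z. poly (pderiv P) z = 0}"
  shows "rsquarefree (P - [:t:])"
  unfolding rsquarefree_roots using assms by (auto simp: pderiv_diff)

lemma degree_diff_const [simp]:
  "degree (P - [:c:]) = degree (P :: 'a :: ring poly)"
  by (cases P) (auto simp: degree_pCons_eq_if)

lemma finite_poly_vimage:
  fixes P :: "complex poly"
  assumes "degree P > 0" "finite T"
  shows "finite (poly P -` T)"
proof -
  have "poly P -` T = (\<Union>t\<in>T. {z. poly (P - [:t:]) z = 0})" by auto
  moreover have "P - [:t:] \<noteq> 0" for t
    using assms(1) by auto
  ultimately show ?thesis using assms(2) by (simp only: finite_UN) (blast intro: poly_roots_finite)
qed

text \<open>Expansion of \<open>h\<close> in powers of \<open>W\<close>, up to constants: the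
  remainder of \<open>h - h(x)\<close> modulo \<open>W - W(x)\<close> vanishes at the
  \<open>degree W\<close> points of \<open>Y\<close>, hence is zero. The quotient has smaller degree
  and is again invariant away from the zeros of \<open>W - W(x)\<close>; this is why the finite
  exceptional set may grow during the induction.\<close>

lemma pcompose_of_fibre_invariant:
  fixes W h :: "complex poly" and R :: "complex \<Rightarrow> complex \<Rightarrow> bool"
  assumes W: "degree W > 0" and "finite S"
    and fib: "\<And>x. x \<notin> S \<Longrightarrow> \<exists>Y. card Y = degree W \<and> (\<forall>y\<in>Y. R x y)"
    and RW: "\<And>x y. x \<notin> S \<Longrightarrow> R x y \<Longrightarrow> poly W y = poly W x"
    and "\<And>x y. x \<notin> S \<Longrightarrow> R x y \<Longrightarrow> poly h y = poly h x"
  shows "\<exists>k. h = pcompose k W"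
  using assms(2-5)
proof (induction "degree h" arbitrary: h S rule: less_induct)
  case (less h S)
  show ?case
  proof (cases "degree h = 0")
    case True
    then obtain c where "h = [:c:]" by (auto elim: degree_eq_zeroE)
    then show ?thesis by (intro exI[of _ "[:c:]"]) simp
  next
    case False
    obtain x where x: "x \<notin> S"
      using less.prems(1) infinite_UNIV_char_0 ex_new_if_finite by blast
    obtain Y where Y: "card Y = degree W" "\<And>y. y \<in> Y \<Longrightarrow> R x y"
      using less.prems(2)[OF x] by blast
    define W0 where "W0 = W - [:poly W x:]"
    have degW0: "degree W0 = degree W"
      unfolding W0_def by simp
    define k where "k = (h - [:poly h x:]) div W0"
    define r where "r = (h - [:poly h x:]) mod W0"
    have eq: "h - [:poly h x:] = k * W0 + r" by (simp add: k_def r_def)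
    have "r = 0"
    proof (rule poly_eqI_degree[of Y])
      show "poly r y = poly 0 y" if "y \<in> Y" for y
      proof -
        have "poly (h - [:poly h x:]) y = 0" "poly W0 y = 0"
          using less.prems(3,4)[OF x Y(2)[OF that]] by (simp_all add: W0_def)
        then show ?thesis using eq by (metis add_0 mult_zero_right poly_0 poly_add poly_mult)
      qed
      show "degree r < card Y"
        using degree_mod_less[of W0 "h - [:poly h x:]"] W degW0 Y(1) unfolding r_def by fastforce
      show "degree (0::complex poly) < card Y" using W Y(1) by simp
    qed
    then have h: "h = [:poly h x:] + k * W0" using eq by (simp add: algebra_simps)
    have k0: "k \<noteq> 0" using h False by (metis add.right_neutral degree_pCons_0 mult_zero_left)
    have W00: "W0 \<noteq> 0" using degW0 W by auto
    have "degree h = degree (h - [:poly h x:])" by simp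
    also have "\<dots> = degree k + degree W"
      using eq \<open>r = 0\<close> k0 W00 degW0 by (simp add: degree_mult_eq)
    finally have deg: "degree k < degree h" using W by simp
    have "\<exists>k'. k = pcompose k' W"
    proof (rule less.hyps[OF deg])
      show "finite (S \<union> {z. poly W0 z = 0})" using less.prems(1) W00 by (simp add: poly_roots_finite)
      fix z assume z: "z \<notin> S \<union> {z. poly W0 z = 0}"
      show "\<exists>Y. card Y = degree W \<and> (\<forall>y\<in>Y. R z y)" using less.prems(2) z by blast
      fix y assume R: "R z y"
      show Wzy: "poly W y = poly W z" using less.prems(3) z R by blast
      have "poly h y = poly h z" using less.prems(4) z R by blast
      then have "poly k y * poly W0 y = poly k z * poly W0 z"
        by (subst (asm) h, subst (asm) (2) h) simp
      moreover have "poly W0 y = poly W0 z" using Wzy by (simp add: W0_def)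
      ultimately show "poly k y = poly k z" using z by simp
    qed
    then obtain k' where k': "k = pcompose k' W" by blast
    show ?thesis
    proof
      show "h = pcompose ([:poly h x:] + k' * [:- poly W x, 1:]) W"
        by (subst h) (simp add: k' pcompose_add pcompose_mult pcompose_diff pcompose_smult W0_def pcompose_pCons algebra_simps)
    qed
  qed
qed

text \<open>The greatest common divisor \<open>\<Phi>\<close> of \<open>P(X) - P(z)\<close> and \<open>Q(X) - Q(z)\<close> in \<open>X\<close> has as its roots over a
  generic \<open>z\<close> the common fibre of \<open>P\<close> and \<open>Q\<close> through \<open>z\<close>, so its coefficients are constant on these
  fibres. Any non-constant coefficient serves as \<open>W\<close>: counting roots in \<open>X\<close> and in \<open>z\<close> shows that its
  degree is exactly the size of the fibre.\<close>

lemma common_right_factor: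
  fixes P Q :: "complex poly"
  assumes degP: "degree P > 0"
  obtains W Pt Qt S where "P = pcompose Pt W" "Q = pcompose Qt W" "finite S"
    "\<And>x y. x \<notin> S \<Longrightarrow> poly P x = poly P y \<Longrightarrow> poly Q x = poly Q y \<Longrightarrow> poly W x = poly W y"
proof -
  let ?c = "\<lambda>F. map_poly (\<lambda>c. [:c:]) F :: complex poly poly"
  let ?ev = "\<lambda>G x y. poly (poly G [:y:]) x :: complex"
  let ?sp = "\<lambda>G x. map_poly (\<lambda>c. poly c x) G :: complex poly"
  define F1 where "F1 = ?c P - [:P:]"
  define F2 where "F2 = ?c Q - [:Q:]"
  have evF1: "?ev F1 x y = poly P y - poly P x" and evF2: "?ev F2 x y = poly Q y - poly Q x" for x y
    by (simp_all add: F1_def F2_def poly_map_const_poly)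
  have degF1: "degree F1 = degree P" by (simp add: F1_def degree_map_poly)
  have lcF1: "lead_coeff F1 = [:lead_coeff P:]"
    using degP unfolding degF1 by (cases "degree P") (simp_all add: F1_def coeff_map_poly)
  have "F1 \<noteq> 0" using degF1 degP by auto
  then obtain \<Phi> D U V where d1: "\<Phi> dvd F1" and d2: "\<Phi> dvd F2" and D: "D \<noteq> 0"
    and bez: "smult D \<Phi> = U * F1 + V * F2"
    by (rule bezout_dvd_poly)
  obtain \<Psi>1 where \<Psi>1: "F1 = \<Phi> * \<Psi>1" using d1 by (elim dvdE)
  obtain \<Psi>2 where \<Psi>2: "F2 = \<Phi> * \<Psi>2" using d2 by (elim dvdE)
  define e where "e = degree \<Phi>"
  \<comment> \<open>The leading coefficient of \<open>F1\<close> in the outer variable is a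
    constant, so that of its divisor \<open>\<Phi>\<close> is one too, and the degree of
    \<open>\<Phi>\<close> survives every specialisation of the inner variable.\<close>
  have "lead_coeff \<Phi> dvd [:lead_coeff P:]"
    unfolding lcF1[symmetric] \<Psi>1 lead_coeff_mult by simp
  then have "degree (lead_coeff \<Phi>) \<le> degree [:lead_coeff P:]"
    by (rule dvd_imp_degree_le) (use degP in auto)
  then obtain k where k: "lead_coeff \<Phi> = [:k:]"
    by (auto elim: degree_eq_zeroE)
  have k0: "k \<noteq> 0"
    using k \<open>F1 \<noteq> 0\<close> \<Psi>1 by (metis leading_coeff_0_iff mult_zero_left pCons_0_0)
  have cosp: "coeff (?sp \<Phi> x) i = poly (coeff \<Phi> i) x" for x i
    by (simp add: coeff_map_poly)
  have degsp: "degree (?sp \<Phi> x) = e" for x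
  proof (rule antisym)
    show "degree (?sp \<Phi> x) \<le> e" by (rule degree_le) (simp add: cosp e_def coeff_eq_0)
    show "e \<le> degree (?sp \<Phi> x)"
      by (rule le_degree) (use k k0 in \<open>simp add: cosp e_def\<close>)
  qed
  have lcsp: "lead_coeff (?sp \<Phi> x) = k" for x
    unfolding degsp using k by (simp add: cosp e_def)

  \<comment> \<open>Excluded are the values of \<open>P\<close> at the zeros of \<open>D\<close>,
    where the Bezout identity says nothing, and at the critical points. Taking full preimages makes
    \<open>S\<close> a union of fibres of \<open>P\<close>.\<close>
  define crit where "crit = poly P ` ({z. poly D z = 0} \<union> {z. poly (pderiv P) z = 0})"
  define S where "S = poly P -` crit"
  have "pderiv P \<noteq> 0" using degP by (simp add: pderiv_eq_0_iff)
  then have "finite crit" unfolding crit_def using D by (intro finite_imageI finite_UnI poly_roots_finite)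
  then have finS: "finite S" unfolding S_def by (rule finite_poly_vimage[OF degP])
  have satS: "y \<notin> S" if "x \<notin> S" "poly P x = poly P y" for x y
    using that by (auto simp: S_def)
  have DS: "poly D x \<noteq> 0" if "x \<notin> S" for x
    using that by (auto simp: S_def crit_def)
  have sqf: "rsquarefree (P - [:poly P x:])" if "x \<notin> S" for x
    using that by (intro rsquarefree_diff_const) (auto simp: S_def crit_def)
  have root: "?ev \<Phi> x y = 0 \<longleftrightarrow> poly P y = poly P x \<and> poly Q y = poly Q x" if "x \<notin> S" for x y
  proof
    assume *: "?ev \<Phi> x y = 0"
    have "?ev F1 x y = 0" "?ev F2 x y = 0" unfolding \<Psi>1 \<Psi>2 using * by simp_all
    then show "poly P y = poly P x \<and> poly Q y = poly Q x"
      unfolding evF1 evF2 by simp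
  next
    assume *: "poly P y = poly P x \<and> poly Q y = poly Q x"
    have "poly D x * ?ev \<Phi> x y = ?ev (smult D \<Phi>) x y" by simp
    also have "\<dots> = ?ev U x y * ?ev F1 x y + ?ev V x y * ?ev F2 x y" unfolding bez by simp
    also have "\<dots> = 0" using * unfolding evF1 evF2 by simp
    finally show "?ev \<Phi> x y = 0" using DS[OF that] by simp
  qed
  have spdvd: "?sp \<Phi> x dvd P - [:poly P x:]" for x
  proof -
    have "P - [:poly P x:] = ?sp \<Phi> x * ?sp \<Psi>1 x"
      
    proof (rule iffD1[OF poly_eq_poly_eq_iff], rule ext)
      fix y
      have "poly (P - [:poly P x:]) y = ?ev (\<Phi> * \<Psi>1) x y"
        unfolding \<Psi>1[symmetric] evF1 by simp
      then show "poly (P - [:poly P x:]) y = poly (?sp \<Phi> x * ?sp \<Psi>1 x) y"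
        by (simp add: poly_map_poly_eval)
    qed
    then show ?thesis by (rule dvdI)
  qed
  have sqfsp: "rsquarefree (?sp \<Phi> x)" if "x \<notin> S" for x
    by (rule rsquarefree_dvd[OF spdvd sqf[OF that]])
  define cl where "cl x = {y. poly P y = poly P x \<and> poly Q y = poly Q x}" for x
  have rootsp: "{y. poly (?sp \<Phi> x) y = 0} = cl x" if "x \<notin> S" for x
    using root[OF that] unfolding cl_def by (simp add: poly_map_poly_eval)
  have cardcl: "card (cl x) = e" if "x \<notin> S" for x
    using card_roots_rsquarefree[OF sqfsp[OF that]] unfolding rootsp[OF that] degsp .
  have sp_eq: "?sp \<Phi> x = ?sp \<Phi> y" if "x \<notin> S" "y \<in> cl x" for x y
  proof -
    have y: "y \<notin> S" using satS that by (auto simp: cl_def)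
    have "cl x = cl y" using that(2) by (auto simp: cl_def)
    then have "smult k (\<Prod>z\<in>cl x. [:-z, 1:]) = smult k (\<Prod>z\<in>cl y. [:-z, 1:])" by simp
    then show ?thesis
      using complex_poly_decompose_rsquarefree[OF sqfsp[OF that(1)]]
        complex_poly_decompose_rsquarefree[OF sqfsp[OF y]]
      unfolding lcsp rootsp[OF that(1)] rootsp[OF y] by (rule box_equals)
  qed
  have coinv: "poly (coeff \<Phi> i) x = poly (coeff \<Phi> i) y" if "x \<notin> S" "y \<in> cl x" for x y i
    using sp_eq[OF that] cosp by metis
  have infS: "infinite (- S)" using finS by (simp add: Compl_eq_Diff_UNIV infinite_UNIV_char_0)

  \<comment> \<open>If all coefficients were constant, every specialisation would be the same
    polynomial \<open>\<phi>\<close>, which would have each \<open>x\<close> outside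
    \<open>S\<close> as a root.\<close>
  obtain i where i: "degree (coeff \<Phi> i) > 0"
  proof (rule ccontr)
    assume "\<not> thesis"
    then have const: "degree (coeff \<Phi> i) = 0" for i using that by blast
    define \<phi> where "\<phi> = ?sp \<Phi> 0"
    have "poly (coeff \<Phi> i) x = poly (coeff \<Phi> i) 0" for i x
      using const[of i] by (auto elim: degree_eq_zeroE)
    then have sp: "?sp \<Phi> x = \<phi>" for x
      unfolding \<phi>_def by (intro poly_eqI) (simp add: cosp)
    have "poly \<phi> x = 0" if "x \<notin> S" for x
    proof -
      have "?ev \<Phi> x x = 0" using root[OF that] by simp
      then show ?thesis using sp[of x] by (metis poly_map_poly_eval)
    qed
    then have "- S \<subseteq> {x. poly \<phi> x = 0}" by auto
    then have "\<phi> = 0" using infS poly_roots_finite finite_subset by blast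
    then show False using lcsp[of 0] k0 unfolding \<phi>_def by simp
  qed
  define W where "W = coeff \<Phi> i"
  have Wcl: "poly W y = poly W x" if "x \<notin> S" "y \<in> cl x" for x y
    using coinv[OF that] by (simp add: W_def)

  have le: "e \<le> degree W"
  proof -
    obtain x where x: "x \<notin> S" using infS by (metis ComplD all_not_in_conv finite.emptyI)
    have nz: "W - [:poly W x:] \<noteq> 0"
      using i degree_diff_const[of W "poly W x"] by (auto simp: W_def simp del: degree_diff_const)
    have "cl x \<subseteq> {y. poly (W - [:poly W x:]) y = 0}" using Wcl[OF x] by auto
    then have "card (cl x) \<le> card {y. poly (W - [:poly W x:]) y = 0}"
      by (rule card_mono[OF poly_roots_finite[OF nz]])
    also have "\<dots> \<le> degree (W - [:poly W x:])" by (rule card_poly_roots_bound[OF nz])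
    finally have "card (cl x) \<le> degree (W - [:poly W x:])" .
    then show ?thesis using cardcl[OF x] by simp
  qed

  have ge: "degree W \<le> e"
  proof -
    \<comment> \<open>Now the outer variable is fixed instead: \<open>\<rho> y\<close> is the
      coefficient of degree \<open>degree W\<close> of \<open>\<Phi>\<close> as a polynomial in the
      inner variable. It is not identically zero, so a generic \<open>y\<close> gives a polynomial
      of degree at least \<open>degree W\<close>, whose roots are simple and lie in
      \<open>cl y\<close>.\<close>
    define \<rho> where "\<rho> = map_poly (\<lambda>c. coeff c (degree W)) \<Phi>"
    have "coeff \<rho> i = lead_coeff W" by (simp add: \<rho>_def coeff_map_poly W_def)
    moreover have "lead_coeff W \<noteq> 0" using i by (auto simp: W_def)
    ultimately have "\<rho> \<noteq> 0" by auto
    then have "infinite (- S - {y. poly \<rho> y = 0})"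
      using infS poly_roots_finite by (metis Diff_infinite_finite)
    then obtain y where y: "y \<notin> S" "poly \<rho> y \<noteq> 0"
      by (metis (mono_tags, lifting) ComplD Diff_iff all_not_in_conv finite.emptyI mem_Collect_eq)
    define p where "p = poly \<Phi> [:y:]"
    have "coeff p (degree W) \<noteq> 0" using y(2) by (simp add: p_def coeff_poly_const \<rho>_def)
    then have "degree W \<le> degree p" by (rule le_degree)
    also have "degree p = card {x. poly p x = 0}"
    proof (rule card_roots_rsquarefree[symmetric], rule rsquarefree_dvd)
      have "poly F1 [:y:] = - (P - [:poly P y:])"
        using evF1[of y] by (auto simp flip: poly_eq_poly_eq_iff simp: fun_eq_iff)
      then have "- (P - [:poly P y:]) = p * poly \<Psi>1 [:y:]" unfolding \<Psi>1 p_def by simp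
      then show "p dvd P - [:poly P y:]" by (metis dvd_minus_iff dvd_triv_left)
      show "rsquarefree (P - [:poly P y:])" by (rule sqf[OF y(1)])
    qed
    also have "{x. poly p x = 0} \<subseteq> cl y"
    proof
      fix x assume "x \<in> {x. poly p x = 0}"
      then have ev: "?ev \<Phi> x y = 0" by (simp add: p_def)
      then have "poly P y = poly P x" using evF1[of y x] unfolding \<Psi>1 by simp
      then have "x \<notin> S" using satS y(1) by metis
      then show "x \<in> cl y" using root[of x y] ev by (simp add: cl_def)
    qed
    then have "card {x. poly p x = 0} \<le> card (cl y)"
      by (rule card_mono[rotated]) (use rootsp[OF y(1)] sqfsp[OF y(1)] in
        \<open>metis poly_roots_finite rsquarefree_def\<close>)
    also have "card (cl y) = e" by (rule cardcl[OF y(1)])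
    finally show ?thesis .
  qed
  have degW: "degree W = e" using le ge by simp
  have W0: "degree W > 0" using i by (simp add: W_def)

  have comp: "\<exists>k. h = pcompose k W" if "\<And>x y. x \<notin> S \<Longrightarrow> y \<in> cl x \<Longrightarrow> poly h y = poly h x" for h
  proof (rule pcompose_of_fibre_invariant[of W S "\<lambda>x y. y \<in> cl x", OF W0 finS])
    show "\<exists>Y. card Y = degree W \<and> (\<forall>y\<in>Y. y \<in> cl x)" if "x \<notin> S" for x
      using cardcl[OF that] degW by (intro exI[of _ "cl x"]) simp
  qed (use Wcl that in auto)
  obtain Pt where Pt: "P = pcompose Pt W" using comp[of P] by (auto simp: cl_def)
  obtain Qt where Qt: "Q = pcompose Qt W" using comp[of Q] by (auto simp: cl_def)
  show thesis
  proof (rule that[OF Pt Qt finS])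
    fix x y assume "x \<notin> S" "poly P x = poly P y" "poly Q x = poly Q y"
    then show "poly W x = poly W y" using Wcl[of x y] by (simp add: cl_def)
  qed
qed

subsection \<open>Polynomials as covering maps\<close>

text \<open>If \<open>\<kappa>\<close> were negative, the real part of the periodic function \<open>u - (\<kappa> / \<tau>) w\<close> would tend to
  \<open>-\<infinity>\<close> on the left, but its mean over a period does not depend on \<open>Re w\<close>.\<close>

lemma shift_nonneg:
  fixes u :: "complex \<Rightarrow> complex" and c C \<tau> \<kappa> :: real
  assumes hol: "u holomorphic_on {w. Re w < c}" and \<tau>: "\<tau> > 0"
    and shift: "\<And>w. Re w < c \<Longrightarrow> u (w + \<i> * \<tau>) = u w + \<i> * \<kappa>"
    and bnd: "\<And>w. Re w < c \<Longrightarrow> Re (u w) \<le> C"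
  shows "0 \<le> \<kappa>"
proof (rule ccontr)
  assume neg: "\<not> 0 \<le> \<kappa>"
  let ?H = "{w. Re w < c}"
  have convH: "convex ?H" by (rule convex_halfspace_Re_lt)
  have openH: "open ?H" by (rule open_halfspace_Re_lt)
  define g where "g w = u w - (\<kappa> / \<tau>) * w" for w :: complex
  have "g holomorphic_on ?H" unfolding g_def by (intro holomorphic_intros hol)
  then obtain G where "\<And>w. w \<in> ?H \<Longrightarrow> (G has_field_derivative g w) (at w within ?H)"
    using holomorphic_convex_primitive' convH openH by blast
  then have G: "(G has_field_derivative g w) (at w)" if "Re w < c" for w
    using that openH by (metis at_within_open mem_Collect_eq)
  have per: "g (w + \<i> * \<tau>) = g w" if "Re w < c" for w
    using shift[OF that] \<tau> by (simp add: g_def field_simps)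
  have "\<exists>K. \<forall>w\<in>?H. G (w + \<i> * \<tau>) - G w = K"
  proof (rule has_field_derivative_zero_constant[OF convH])
    fix w assume "w \<in> ?H"
    then have w: "Re w < c" by simp
    have "((\<lambda>w. G (w + \<i> * \<tau>) - G w) has_field_derivative g (w + \<i> * \<tau>) * 1 - g w) (at w)"
      by (rule DERIV_diff[OF DERIV_chain2[OF G] G]) (use w in \<open>auto intro!: derivative_eq_intros\<close>)
    then show "((\<lambda>w. G (w + \<i> * \<tau>) - G w) has_field_derivative 0) (at w within ?H)"
      using per[OF w] by (simp add: has_field_derivative_at_within)
  qed
  then obtain K where K: "\<And>w. Re w < c \<Longrightarrow> G (w + \<i> * \<tau>) - G w = K" by auto
  \<comment> \<open>\<open>Im K / \<tau>\<close> is the mean of \<open>Re g\<close> over a vertical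
    period, and the mean value theorem finds a \<open>y\<close> where it is attained. There
    \<open>Re g\<close> is at most \<open>C - (\<kappa> / \<tau>) * x\<close>, which tends to minus
    infinity with \<open>x\<close> when \<open>\<kappa>\<close> is negative.\<close>
  have le: "Im K \<le> \<tau> * C - \<kappa> * x" if x: "x < c" for x
  proof -
    have der: "((\<lambda>y. Im (G (x + \<i> * of_real y))) has_real_derivative Re (g (x + \<i> * of_real y))) (at y)" for y
    proof -
      have "((\<lambda>y. x + \<i> * of_real y) has_vector_derivative \<i>) (at y)"
        by (auto intro!: derivative_eq_intros)
      moreover have "(G has_field_derivative g (x + \<i> * of_real y)) (at (x + \<i> * of_real y))"
        by (rule G) (use x in simp)
      ultimately have "((\<lambda>y. G (x + \<i> * of_real y)) has_vector_derivative \<i> * g (x + \<i> * of_real y)) (at y)"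
        by (rule field_vector_diff_chain_at[unfolded o_def])
      then have "((\<lambda>y. Im (G (x + \<i> * of_real y))) has_vector_derivative Im (\<i> * g (x + \<i> * of_real y))) (at y)"
        by (rule bounded_linear.has_vector_derivative[OF bounded_linear_Im])
      then show ?thesis by (simp add: has_real_derivative_iff_has_vector_derivative)
    qed
    obtain y where "Im (G (x + \<i> * of_real \<tau>)) - Im (G (x + \<i> * of_real 0)) = (\<tau> - 0) * Re (g (x + \<i> * of_real y))"
      using MVT2[OF \<tau> der] by blast
    then have "Im K = \<tau> * Re (g (x + \<i> * of_real y))"
      using K[of x] x by (auto simp flip: minus_complex.simps)
    also have "\<dots> = \<tau> * Re (u (x + \<i> * of_real y)) - \<kappa> * x"
      using \<tau> by (simp add: g_def field_simps)
    also have "\<dots> \<le> \<tau> * C - \<kappa> * x"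
      using bnd[of "x + \<i> * of_real y"] x \<tau> by simp
    finally show ?thesis .
  qed
  define x where "x = min (c - 1) ((Im K - \<tau> * C) / (- \<kappa>) - 1)"
  have "x < c" "x < (Im K - \<tau> * C) / (- \<kappa>)" by (auto simp: x_def)
  then have "x * (- \<kappa>) < Im K - \<tau> * C" using neg pos_less_divide_eq[of "- \<kappa>" x "Im K - \<tau> * C"] by linarith
  then show False using le[OF \<open>x < c\<close>] by (simp add: algebra_simps)
qed

text \<open>Around the \<open>degree P\<close> simple preimages of a regular value, disjoint discs
  are chosen on which \<open>P\<close> is injective. A value in the intersection \<open>T\<close> of
  their images has one preimage in each disc, and by counting these are all its preimages.\<close>

lemma covering_space_poly:
  fixes P :: "complex poly"
  assumes degP: "degree P > 0" and "finite bad" and crit: "poly P ` {z. poly (pderiv P) z = 0} \<subseteq> bad"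
  shows "covering_space (poly P -` (- bad)) (poly P) (- bad)"
proof
  let ?V = "- bad"
  have openV: "open ?V" using \<open>finite bad\<close> by (simp add: finite_imp_closed open_Compl)
  have contP: "continuous_on A (poly P)" for A by (intro continuous_intros)
  have holP: "poly P holomorphic_on A" for A by (intro holomorphic_intros)
  show "continuous_on (poly P -` ?V) (poly P)" by (rule contP)
  have surj: "\<exists>z. poly P z = t" for t
    using fundamental_theorem_of_algebra_alt[of "P - [:t:]"] degP
    by (metis degree_diff_const degree_pCons_0 diff_eq_diff_eq eq_iff_diff_eq_0 less_irrefl poly_diff poly_pCons mult_zero_right poly_0 add.right_neutral)
  then have "surj (poly P)" by (metis surjI)
  then show "poly P ` (poly P -` ?V) = ?V" by (simp add: surj_image_vimage_eq)
  fix t assume t: "t \<in> ?V"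
  define R where "R = {z. poly P z = t}"
  have R': "R = {z. poly (P - [:t:]) z = 0}" by (simp add: R_def)
  have sqf: "rsquarefree (P - [:t:])" by (rule rsquarefree_diff_const) (use t crit in blast)
  have cardR: "card R = degree P"
    unfolding R' card_roots_rsquarefree[OF sqf] by simp
  have finR: "finite R" unfolding R' by (rule poly_roots_finite) (use degP in auto)
  \<comment> \<open>The entry 2 is arbitrary; it keeps the set non-empty when the fibre is a single
    point.\<close>
  define \<Delta> where "\<Delta> = insert 2 ((\<lambda>(r, r'). dist r r') ` (R \<times> R - Id))"
  define \<delta> where "\<delta> = Min \<Delta> / 2"
  have fin\<Delta>: "finite \<Delta>" unfolding \<Delta>_def using finR by blast
  have "\<forall>d\<in>\<Delta>. d > 0" "\<Delta> \<noteq> {}" by (auto simp: \<Delta>_def)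
  then have \<delta>0: "\<delta> > 0" using Min_in[OF fin\<Delta>] by (auto simp: \<delta>_def)
  have \<delta>: "2 * \<delta> \<le> dist r r'" if "r \<in> R" "r' \<in> R" "r \<noteq> r'" for r r'
  proof -
    have "dist r r' \<in> \<Delta>" using that by (force simp: \<Delta>_def)
    then show ?thesis unfolding \<delta>_def using Min_le[OF fin\<Delta>] by simp
  qed
  have "\<exists>\<rho>>0. inj_on (poly P) (ball r \<rho>)" if "r \<in> R" for r
  proof -
    have "poly (pderiv P) r \<noteq> 0" using that t crit by (auto simp: R_def)
    then have "deriv (poly P) r \<noteq> 0" by (simp add: DERIV_imp_deriv[OF poly_DERIV])
    then show ?thesis
      using has_complex_derivative_locally_injective[OF holP[of UNIV], of r] by auto
  qed
  then obtain \<rho> where \<rho>: "\<And>r. r \<in> R \<Longrightarrow> \<rho> r > 0 \<and> inj_on (poly P) (ball r (\<rho> r))" by metis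
  define O' where "O' r = ball r (min (\<rho> r) \<delta>)" for r
  have O'_in: "r \<in> O' r" if "r \<in> R" for r
    using \<rho>[OF that] \<delta>0 by (simp add: O'_def)
  have O'_inj: "inj_on (poly P) (O' r)" if "r \<in> R" for r
    by (rule inj_on_subset[OF conjunct2[OF \<rho>[OF that]]]) (simp add: O'_def subset_ball)
  have O'_open: "open (O' r)" for r by (simp add: O'_def)
  have O'_disj: "O' r \<inter> O' r' = {}" if "r \<in> R" "r' \<in> R" "r \<noteq> r'" for r r'
  proof -
    have False if "z \<in> O' r" "z \<in> O' r'" for z
      using that \<delta>[OF \<open>r \<in> R\<close> \<open>r' \<in> R\<close> \<open>r \<noteq> r'\<close>] dist_triangle2[of r r' z]
      by (auto simp: O'_def)
    then show ?thesis by blast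
  qed
  define T where "T = ?V \<inter> (\<Inter>r\<in>R. poly P ` O' r)"
  define u where "u r = O' r \<inter> poly P -` T" for r
  have openT: "open T" unfolding T_def
    by (intro open_Int openV open_INT finR ballI open_mapping_thm3[OF holP O'_open O'_inj])
  have tT: "t \<in> T" using t O'_in by (fastforce simp: T_def R_def)
  have openu: "open (u r)" for r unfolding u_def
    by (intro open_Int O'_open continuous_open_preimage[of UNIV, simplified] openT contP)
  have Union: "\<Union> (u ` R) = poly P -` ?V \<inter> poly P -` T"
  proof
    show "\<Union> (u ` R) \<subseteq> poly P -` ?V \<inter> poly P -` T" by (auto simp: u_def T_def)
    show "poly P -` ?V \<inter> poly P -` T \<subseteq> \<Union> (u ` R)"
    proof
      fix x assume x: "x \<in> poly P -` ?V \<inter> poly P -` T"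
      then have "\<forall>r\<in>R. \<exists>y. y \<in> O' r \<and> poly P y = poly P x" by (auto simp: T_def) (metis imageE)
      then obtain y where y: "\<And>r. r \<in> R \<Longrightarrow> y r \<in> O' r \<and> poly P (y r) = poly P x" by metis
      have inj: "inj_on y R"
      proof (rule inj_onI, rule ccontr)
        fix r r' assume "r \<in> R" "r' \<in> R" "y r = y r'" "r \<noteq> r'"
        then show False using y[of r] y[of r'] O'_disj[of r r'] by auto
      qed
      let ?Z = "{z. poly (P - [:poly P x:]) z = 0}"
      have nz: "P - [:poly P x:] \<noteq> 0" using degP degree_pCons_0 by (metis eq_iff_diff_eq_0 less_irrefl)
      have "y ` R = ?Z"
      proof (rule card_seteq)
        show "finite ?Z" by (rule poly_roots_finite[OF nz])
        show "y ` R \<subseteq> ?Z" using y by auto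
        show "card ?Z \<le> card (y ` R)"
          using card_poly_roots_bound[OF nz] card_image[OF inj] cardR by simp
      qed
      moreover have "x \<in> ?Z" by simp
      ultimately obtain r where "r \<in> R" "x = y r" by (metis imageE)
      then have "x \<in> u r" using y[of r] x by (simp add: u_def)
      then show "x \<in> \<Union> (u ` R)" using \<open>r \<in> R\<close> by blast
    qed
  qed
  show "\<exists>T. t \<in> T \<and> openin (top_of_set ?V) T \<and>
           (\<exists>v. \<Union>v = poly P -` ?V \<inter> poly P -` T \<and>
             (\<forall>u\<in>v. openin (top_of_set (poly P -` ?V)) u) \<and>
             pairwise disjnt v \<and> (\<forall>u\<in>v. \<exists>q. homeomorphism u T (poly P) q))"
  proof (intro exI[of _ T] conjI exI[of _ "u ` R"] ballI)
    show "t \<in> T" by (rule tT)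
    show "openin (top_of_set ?V) T" using openT openV by (auto simp: openin_open_eq T_def)
    show "\<Union> (u ` R) = poly P -` ?V \<inter> poly P -` T" by (rule Union)
    show "pairwise disjnt (u ` R)"
      unfolding pairwise_image
    proof (rule pairwiseI)
      fix r r' assume "r \<in> R" "r' \<in> R" "r \<noteq> r'"
      then show "u r \<noteq> u r' \<longrightarrow> disjnt (u r) (u r')"
        using O'_disj[of r r'] by (auto simp: disjnt_def u_def)
    qed
  next
    fix U assume "U \<in> u ` R"
    then obtain r where r: "r \<in> R" "U = u r" by blast
    have "open (poly P -` ?V)"
      by (intro continuous_open_preimage[of UNIV, simplified] openV contP)
    moreover have "u r \<subseteq> poly P -` ?V" by (auto simp: u_def T_def)
    ultimately show "openin (top_of_set (poly P -` ?V)) U"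
      using openu r by (simp add: openin_open_eq)
    have "inj_on (poly P) (u r)" using O'_inj[OF r(1)] by (rule inj_on_subset) (auto simp: u_def)
    then obtain q where "homeomorphism (u r) (poly P ` u r) (poly P) q"
      using invariance_of_domain_homeomorphism[of "u r" "poly P"] openu contP by auto
    moreover have "poly P ` u r = T"
    proof -
      have "T \<subseteq> poly P ` O' r" using r(1) by (auto simp: T_def)
      then show ?thesis unfolding u_def by blast
    qed
    ultimately show "\<exists>q. homeomorphism U T (poly P) q" using r by auto
  qed
qed

lemma poly_lift_exists:
  fixes P :: "complex poly"
  assumes "degree P > 0" "finite bad" "poly P ` {z. poly (pderiv P) z = 0} \<subseteq> bad"
    and D: "open D" "simply_connected D" "w0 \<in> D"
    and f: "f holomorphic_on D" "f \<in> D \<rightarrow> - bad" and r: "poly P r = f w0"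
  obtains g where "g holomorphic_on D" "g w0 = r" "\<And>w. w \<in> D \<Longrightarrow> poly P (g w) = f w"
proof -
  note cov = covering_space_poly[OF assms(1-3)]
  have lpc: "locally path_connected D" using D(1) by (rule open_imp_locally_path_connected)
  have rC: "r \<in> poly P -` (- bad)" using r f(2) D(3) by auto
  obtain g where g: "continuous_on D g" "g \<in> D \<rightarrow> poly P -` (- bad)" "g w0 = r"
    "\<And>w. w \<in> D \<Longrightarrow> poly P (g w) = f w"
    by (rule covering_space_lift_strong[OF cov rC D(3) D(2) lpc
          holomorphic_on_imp_continuous_on[OF f(1)] f(2) r[symmetric]]) blast
  have "open (poly P -` (- bad))"
    using \<open>finite bad\<close> by (intro continuous_open_preimage[of UNIV, simplified])
      (auto simp: finite_imp_closed open_Compl intro!: continuous_intros)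
  then have "g holomorphic_on D"
    by (rule covering_space_lift_is_holomorphic[OF cov _ _ f g(2,1,4)]) (auto intro!: holomorphic_intros)
  then show thesis using that g by blast
qed

lemma poly_lift_unique:
  fixes P :: "complex poly"
  assumes "degree P > 0" "finite bad" "poly P ` {z. poly (pderiv P) z = 0} \<subseteq> bad"
    and "connected D" "w0 \<in> D" "w \<in> D"
    and g: "g holomorphic_on D" "h holomorphic_on D" "g w0 = h w0"
    and eq: "\<And>w. w \<in> D \<Longrightarrow> poly P (g w) = poly P (h w)" "\<And>w. w \<in> D \<Longrightarrow> poly P (g w) \<notin> bad"
  shows "g w = h w"
  by (rule covering_space_lift_unique[OF covering_space_poly[OF assms(1-3)], where f = "\<lambda>w. poly P (g w)",
        OF g(3) _ _ holomorphic_on_imp_continuous_on[OF g(1)] _ refl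
          holomorphic_on_imp_continuous_on[OF g(2)] _ _ assms(4-6)])
    (use eq g in \<open>auto intro!: continuous_intros intro: holomorphic_on_imp_continuous_on\<close>)

subsection \<open>The logarithmic relation\<close>

lemma has_contour_integral_poly_deriv:
  "(poly (pderiv F) has_contour_integral poly F b - poly F a) (linepath a b)"
  using contour_integral_primitive[of UNIV "poly F" "poly (pderiv F)" "linepath a b"]
  by (simp add: poly_DERIV)

text \<open>Integration by parts: the derivative of \<open>Q * P ^ Suc i\<close> integrates to zero
  because \<open>Q\<close> vanishes at both endpoints.\<close>

lemma moments_pderiv_zero:
  fixes P Q :: "complex poly"
  assumes mom: "\<And>i. contour_integral (linepath a b) (\<lambda>z. poly P z ^ i * poly (pderiv Q) z) = 0"
    and Qa: "poly Q a = 0" and Qb: "poly Q b = 0"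
  shows "((\<lambda>z. poly Q z * poly (pderiv P) z * poly P z ^ i) has_contour_integral 0) (linepath a b)"
proof -
  have "((\<lambda>z. poly P z ^ Suc i * poly (pderiv Q) z) has_contour_integral 0) (linepath a b)"
    unfolding mom[of "Suc i", symmetric]
    by (intro has_contour_integral_integral contour_integrable_continuous_linepath continuous_intros)
  moreover have "(poly (pderiv (Q * P ^ Suc i)) has_contour_integral 0) (linepath a b)"
    using has_contour_integral_poly_deriv[of "Q * P ^ Suc i" b a] Qa Qb by simp
  ultimately have "((\<lambda>z. (1 / of_nat (Suc i)) * (poly (pderiv (Q * P ^ Suc i)) z - poly P z ^ Suc i * poly (pderiv Q) z))
      has_contour_integral (1 / of_nat (Suc i)) * (0 - 0)) (linepath a b)"
    by (intro has_contour_integral_lmul has_contour_integral_diff)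
  moreover have "(1 / of_nat (Suc i)) * (poly (pderiv (Q * P ^ Suc i)) z - poly P z ^ Suc i * poly (pderiv Q) z)
      = poly Q z * poly (pderiv P) z * poly P z ^ i" for z
  proof -
    have "poly (pderiv (Q * P ^ Suc i)) z - poly P z ^ Suc i * poly (pderiv Q) z
      = of_nat (Suc i) * (poly Q z * poly (pderiv P) z * poly P z ^ i)"
      by (simp add: pderiv_mult pderiv_power_Suc algebra_simps del: of_nat_Suc power_Suc)
    then show ?thesis by (simp del: of_nat_Suc)
  qed
  ultimately show ?thesis by simp
qed

text \<open>The function \<open>\<integral> Q P' / (P - t)\<close> is, up to sign, the generating function in
  \<open>1 / t\<close> of the moments; the estimate below replaces its expansion.\<close>

lemma moment_generating_zero:
  fixes P Q :: "complex poly"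
  assumes mom: "\<And>i. ((\<lambda>z. poly Q z * poly (pderiv P) z * poly P z ^ i) has_contour_integral 0) (linepath a b)"
    and T: "\<And>z. z \<in> closed_segment a b \<Longrightarrow> norm (poly P z) \<le> T" "T < norm t"
  shows "((\<lambda>z. poly Q z * poly (pderiv P) z / (poly P z - t)) has_contour_integral 0) (linepath a b)"
proof -
  let ?h = "\<lambda>k z. poly Q z * poly (pderiv P) z * poly P z ^ k / (poly P z - t)"
  have ne: "poly P z - t \<noteq> 0" if "z \<in> closed_segment a b" for z
    using T(1)[OF that] T(2) by auto
  have cont: "continuous_on (closed_segment a b) (?h k)" for k
    using ne by (intro continuous_intros) auto
  define J where "J k = contour_integral (linepath a b) (?h k)" for k
  have J: "(?h k has_contour_integral J k) (linepath a b)" for k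
    unfolding J_def
    by (intro has_contour_integral_integral contour_integrable_continuous_linepath cont)
  \<comment> \<open>This is \<open>P / (P - t) = 1 + t / (P - t)\<close> together with a vanishing
    moment. Hence \<open>J k = t ^ k * J 0\<close>, whereas \<open>J k\<close> grows at most like
    \<open>T ^ k\<close> with \<open>T < norm t\<close>; so \<open>J 0\<close> is zero.\<close>
  have rec: "J (Suc k) = t * J k" for k
  proof -
    have "((\<lambda>z. t * ?h k z + poly Q z * poly (pderiv P) z * poly P z ^ k) has_contour_integral t * J k + 0)
        (linepath a b)"
      by (intro has_contour_integral_add has_contour_integral_lmul J mom)
    then have "(?h (Suc k) has_contour_integral t * J k + 0) (linepath a b)"
    proof (rule has_contour_integral_eq)
      fix z assume "z \<in> path_image (linepath a b)"
      then show "t * ?h k z + poly Q z * poly (pderiv P) z * poly P z ^ k = ?h (Suc k) z"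
        using ne[of z] by (simp add: field_simps)
    qed
    from has_contour_integral_unique[OF J this] show ?thesis by simp
  qed
  have Jk: "J k = t ^ k * J 0" for k by (induction k) (auto simp: rec)
  have "bounded (?h 0 ` closed_segment a b)"
    by (intro compact_imp_bounded compact_continuous_image cont) auto
  then obtain C where C: "\<And>z. z \<in> closed_segment a b \<Longrightarrow> norm (?h 0 z) \<le> C"
    unfolding bounded_iff by auto
  have C0: "C \<ge> 0" using C[of a] norm_ge_zero order_trans by blast
  have T0: "T \<ge> 0" using T(1)[of a] norm_ge_zero order_trans by (metis ends_in_segment(1))
  have tpos: "norm t > 0" using T0 T(2) by linarith
  have bnd: "norm (J 0) \<le> (C * norm (b - a)) * (T / norm t) ^ k" for k
  proof -
    have "norm (J k) \<le> (C * T ^ k) * norm (b - a)"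
    proof (rule has_contour_integral_bound_linepath[OF J])
      fix z assume z: "z \<in> closed_segment a b"
      have "norm (?h k z) = norm (?h 0 z) * norm (poly P z) ^ k"
        by (simp add: norm_mult norm_divide norm_power)
      also have "\<dots> \<le> C * T ^ k"
        using C[OF z] T(1)[OF z] C0 by (intro mult_mono power_mono) auto
      finally show "norm (?h k z) \<le> C * T ^ k" .
    qed (use C0 T0 in auto)
    then show ?thesis unfolding Jk[of k] using tpos
      by (simp add: norm_mult norm_power power_divide field_simps)
  qed
  have "(\<lambda>k. (C * norm (b - a)) * (T / norm t) ^ k) \<longlonglongrightarrow> (C * norm (b - a)) * 0"
    using T0 T(2) tpos by (intro tendsto_mult tendsto_const LIMSEQ_power_zero) simp
  then have "norm (J 0) \<le> 0"
    by (intro tendsto_lowerbound[of _ _ sequentially "norm (J 0)"]) (use bnd in auto)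
  then show ?thesis using J[of 0] by simp
qed

text \<open>Along the segment \<open>(z - x) / (a - x)\<close> stays at distance less than 1 from 1,
  so its principal logarithm is a primitive.\<close>

lemma has_contour_integral_inverse_Ln:
  assumes "norm (b - a) < norm (x - a)"
  shows "((\<lambda>z. 1 / (z - x)) has_contour_integral Ln ((b - x) / (a - x))) (linepath a b)"
proof -
  have ax: "a - x \<noteq> 0" using assms by auto
  let ?F = "\<lambda>z. Ln ((z - x) / (a - x))"
  have "((\<lambda>z. 1 / (z - x)) has_contour_integral ?F (pathfinish (linepath a b)) - ?F (pathstart (linepath a b)))
      (linepath a b)"
  proof (rule contour_integral_primitive)
    fix z assume z: "z \<in> closed_segment a b"
    have "norm (z - a) \<le> norm (b - a)"
      using segment_bound(1)[OF z] .
    then have "norm ((z - a) / (a - x)) < 1"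
      using assms by (simp add: norm_divide norm_minus_commute divide_less_eq)
    moreover have eq: "(z - x) / (a - x) = 1 + (z - a) / (a - x)" using ax by (simp add: field_simps)
    ultimately have "Re ((z - x) / (a - x)) > 0"
      using abs_Re_le_cmod[of "(z - a) / (a - x)"] by simp
    then have nn: "(z - x) / (a - x) \<notin> \<real>\<^sub>\<le>\<^sub>0" by (auto simp: complex_nonpos_Reals_iff)
    then have "z - x \<noteq> 0" by auto
    have "((\<lambda>z. (z - x) / (a - x)) has_field_derivative 1 / (a - x)) (at z)"
      using ax by (auto intro!: derivative_eq_intros)
    from DERIV_chain2[OF has_field_derivative_Ln[OF nn] this]
    have "(?F has_field_derivative (1 / (a - x)) / ((z - x) / (a - x))) (at z)"
      by (simp add: field_class.field_divide_inverse mult.commute)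
    moreover have "(1 / (a - x)) / ((z - x) / (a - x)) = 1 / (z - x)"
      using ax by simp
    ultimately have "(?F has_field_derivative 1 / (z - x)) (at z)" by metis
    then show "(?F has_field_derivative 1 / (z - x)) (at z within closed_segment a b)"
      by (simp add: has_field_derivative_at_within)
  qed auto
  then show ?thesis using ax by simp
qed

text \<open>Induction on the coefficients of \<open>Q\<close>, using \<open>(c + z * Q z) / (z - x)
  = c / (z - x) + x * Q z / (z - x) + Q z\<close>. The last term contributes the constant
  \<open>I\<close>, so the part without logarithm remains polynomial in \<open>x\<close>.\<close>

lemma cauchy_transform_poly:
  fixes Q :: "complex poly"
  obtains \<Theta> :: "complex poly" where
    "\<And>x. norm (b - a) < norm (x - a) \<Longrightarrow> ((\<lambda>z. poly Q z / (z - x)) has_contour_integral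
      poly Q x * Ln ((b - x) / (a - x)) + poly \<Theta> x) (linepath a b)"
proof -
  have "\<exists>\<Theta> :: complex poly. \<forall>x. norm (b - a) < norm (x - a) \<longrightarrow>
    ((\<lambda>z. poly Q z / (z - x)) has_contour_integral
      poly Q x * Ln ((b - x) / (a - x)) + poly \<Theta> x) (linepath a b)"
  proof (induction Q)
    case 0
    show ?case by (intro exI[of _ 0]) (simp add: has_contour_integral_0)
  next
    case (pCons c Q)
    then obtain \<Theta> :: "complex poly" where \<Theta>: "\<And>x. norm (b - a) < norm (x - a) \<Longrightarrow>
      ((\<lambda>z. poly Q z / (z - x)) has_contour_integral
        poly Q x * Ln ((b - x) / (a - x)) + poly \<Theta> x) (linepath a b)" by blast
    define I where "I = contour_integral (linepath a b) (poly Q)"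
    have I: "(poly Q has_contour_integral I) (linepath a b)"
      unfolding I_def
      by (intro has_contour_integral_integral contour_integrable_continuous_linepath continuous_intros)
    show ?case
    proof (intro exI[of _ "pCons I \<Theta>"] allI impI)
      fix x assume x: "norm (b - a) < norm (x - a)"
      have "((\<lambda>z. c * (1 / (z - x)) + x * (poly Q z / (z - x)) + poly Q z) has_contour_integral
          c * Ln ((b - x) / (a - x)) + x * (poly Q x * Ln ((b - x) / (a - x)) + poly \<Theta> x) + I) (linepath a b)"
        by (intro has_contour_integral_add has_contour_integral_lmul \<Theta> x I has_contour_integral_inverse_Ln)
      then have "((\<lambda>z. poly (pCons c Q) z / (z - x)) has_contour_integral
          c * Ln ((b - x) / (a - x)) + x * (poly Q x * Ln ((b - x) / (a - x)) + poly \<Theta> x) + I) (linepath a b)"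
      proof (rule has_contour_integral_eq)
        fix z assume "z \<in> path_image (linepath a b)"
        then have "norm (z - a) \<le> norm (b - a)" by (simp add: segment_bound(1))
        then have zx: "z - x \<noteq> 0" using x by auto
        define d where "d = z - x"
        have "c * (1 / d) + x * (poly Q z / d) + poly Q z = (c + (x + d) * poly Q z) / d"
          using zx by (simp add: d_def[symmetric] add_divide_distrib distrib_right)
        then show "c * (1 / (z - x)) + x * (poly Q z / (z - x)) + poly Q z = poly (pCons c Q) z / (z - x)"
          by (simp add: d_def)
      qed
      then show "((\<lambda>z. poly (pCons c Q) z / (z - x)) has_contour_integral
          poly (pCons c Q) x * Ln ((b - x) / (a - x)) + poly (pCons I \<Theta>) x) (linepath a b)"
        by (simp add: algebra_simps)
    qed
  qed
  then show thesis using that by blast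
qed

lemma pderiv_over_poly_rsquarefree:
  fixes p :: "complex poly"
  assumes "rsquarefree p" "poly p z \<noteq> 0"
  shows "poly (pderiv p) z / poly p z = (\<Sum>x | poly p x = 0. 1 / (z - x))"
proof -
  let ?R = "{x. poly p x = 0}"
  have "p \<noteq> 0" using assms by auto
  then have fin: "finite ?R" by (rule poly_roots_finite)
  have p: "p = smult (lead_coeff p) (\<Prod>x\<in>?R. [:-x, 1:])"
    using complex_poly_decompose_rsquarefree[OF assms(1)] by simp
  have "poly (pderiv p) z = lead_coeff p * (\<Sum>x\<in>?R. \<Prod>y\<in>?R - {x}. z - y)"
    by (subst p) (simp add: pderiv_smult pderiv_prod poly_sum poly_prod pderiv_pCons)
  also have "(\<Sum>x\<in>?R. \<Prod>y\<in>?R - {x}. z - y) = (\<Sum>x\<in>?R. (\<Prod>y\<in>?R. z - y) * (1 / (z - x)))"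
  proof (rule sum.cong)
    fix x assume x: "x \<in> ?R"
    then have "z - x \<noteq> 0" using assms(2) by auto
    then show "(\<Prod>y\<in>?R - {x}. z - y) = (\<Prod>y\<in>?R. z - y) * (1 / (z - x))"
      using prod.remove[OF fin x, of "\<lambda>y. z - y"] by simp
  qed simp
  also have "\<dots> = (\<Prod>y\<in>?R. z - y) * (\<Sum>x\<in>?R. 1 / (z - x))" by (simp add: sum_distrib_left)
  also have "lead_coeff p * ((\<Prod>y\<in>?R. z - y) * (\<Sum>x\<in>?R. 1 / (z - x))) = poly p z * (\<Sum>x\<in>?R. 1 / (z - x))"
    by (subst (4) p) (simp add: poly_prod)
  finally show ?thesis using assms(2) by simp
qed

text \<open>\<open>T\<close> bounds \<open>P\<close> on the closed disc about \<open>a\<close> with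
  \<open>b\<close> on its boundary, so all preimages of a larger \<open>t\<close> lie outside it.
  The partial fraction expansion of \<open>P' / (P - t)\<close> then splits the vanishing integral
  into Cauchy transforms of \<open>Q\<close>.\<close>

lemma moments_log_relation:
  fixes P Q :: "complex poly"
  assumes mom: "\<And>i. contour_integral (linepath a b) (\<lambda>z. poly P z ^ i * poly (pderiv Q) z) = 0"
    and Qa: "poly Q a = 0" and Qb: "poly Q b = 0"
  obtains \<Theta> :: "complex poly" and T where
    "\<And>t x. T < norm t \<Longrightarrow> poly P x = t \<Longrightarrow> norm (b - a) < norm (x - a)"
    "\<And>t. T < norm t \<Longrightarrow> rsquarefree (P - [:t:]) \<Longrightarrow>
      (\<Sum>x | poly P x = t. poly Q x * Ln ((b - x) / (a - x)) + poly \<Theta> x) = 0"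
proof -
  obtain \<Theta> :: "complex poly" where \<Theta>: "\<And>x. norm (b - a) < norm (x - a) \<Longrightarrow>
    ((\<lambda>z. poly Q z / (z - x)) has_contour_integral
      poly Q x * Ln ((b - x) / (a - x)) + poly \<Theta> x) (linepath a b)"
    by (rule cauchy_transform_poly[where Q = Q and a = a and b = b]) blast
  have "bounded (poly P ` cball a (norm (b - a)))"
    by (intro compact_imp_bounded compact_continuous_image continuous_intros) auto
  then obtain T where "\<forall>y \<in> poly P ` cball a (norm (b - a)). norm y \<le> T"
    unfolding bounded_iff by blast
  then have T: "norm (poly P z) \<le> T" if "norm (z - a) \<le> norm (b - a)" for z
    using that by (simp add: dist_norm norm_minus_commute)
  have seg: "norm (z - a) \<le> norm (b - a)" if "z \<in> closed_segment a b" for z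
    using segment_bound(1)[OF that] .
  have large: "norm (b - a) < norm (x - a)" if "T < norm t" "poly P x = t" for t x
    using T[of x] that by (metis not_less)
  show thesis
  proof (rule that[of T \<Theta>, OF large])
    fix t assume t: "T < norm t" and sqf: "rsquarefree (P - [:t:])"
    let ?R = "{x. poly P x = t}"
    have R: "?R = {x. poly (P - [:t:]) x = 0}" by simp
    have "P - [:t:] \<noteq> 0" using sqf by (auto simp: rsquarefree_def)
    then have fin: "finite ?R" unfolding R by (rule poly_roots_finite)
    have "((\<lambda>z. \<Sum>x\<in>?R. poly Q z / (z - x)) has_contour_integral
        (\<Sum>x\<in>?R. poly Q x * Ln ((b - x) / (a - x)) + poly \<Theta> x)) (linepath a b)"
      by (intro has_contour_integral_sum fin \<Theta> large[OF t]) simp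
    moreover have "((\<lambda>z. poly Q z * poly (pderiv P) z / (poly P z - t)) has_contour_integral 0) (linepath a b)"
      by (rule moment_generating_zero[OF moments_pderiv_zero[OF mom Qa Qb] T[OF seg] t])
    then have "((\<lambda>z. \<Sum>x\<in>?R. poly Q z / (z - x)) has_contour_integral 0) (linepath a b)"
    proof (rule has_contour_integral_eq)
      fix z assume "z \<in> path_image (linepath a b)"
      then have "poly (P - [:t:]) z \<noteq> 0" using T[OF seg[of z]] t by auto
      from pderiv_over_poly_rsquarefree[OF sqf this]
      have "poly (pderiv P) z / (poly P z - t) = (\<Sum>x\<in>?R. 1 / (z - x))"
        by (simp add: pderiv_diff pderiv_pCons)
      then have "poly Q z * (poly (pderiv P) z / (poly P z - t)) = (\<Sum>x\<in>?R. poly Q z * (1 / (z - x)))"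
        by (simp only: sum_distrib_left)
      then show "poly Q z * poly (pderiv P) z / (poly P z - t) = (\<Sum>x\<in>?R. poly Q z / (z - x))"
        by simp
    qed
    ultimately show "(\<Sum>x\<in>?R. poly Q x * Ln ((b - x) / (a - x)) + poly \<Theta> x) = 0"
      by (rule has_contour_integral_unique)
  qed
qed

subsection \<open>Branches of the inverse and their winding numbers\<close>

text \<open>Loops of the parameter \<open>t = \<alpha> + exp w\<close> around \<open>\<alpha>\<close> become translations of \<open>w\<close>
  by \<open>2 \<pi> \<i> k\<close>.\<close>

definition per :: "nat \<Rightarrow> complex" where
  "per k = \<i> * of_real (2 * pi * real k)"

lemma per_simps [simp]: "Re (per k) = 0" "per 0 = 0"
  by (simp_all add: per_def)

lemma per_add: "per (j + k) = per j + per k"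
  by (simp add: per_def algebra_simps)

lemma exp_per [simp]: "exp (w + per k) = exp w"
proof -
  have "exp (per k) = 1" unfolding exp_eq_1 per_def by (auto intro!: exI[of _ "int k"])
  then show ?thesis by (simp add: exp_add)
qed

text \<open>The difference is continuous with values in the discrete set of integer multiples of
  \<open>2 * pi * \<i>\<close>.\<close>

lemma exp_eq_imp_diff_const:
  fixes u v :: "complex \<Rightarrow> complex"
  assumes "connected X" "continuous_on X u" "continuous_on X v"
    and eq: "\<And>w. w \<in> X \<Longrightarrow> exp (u w) = exp (v w)"
  obtains m :: int where "\<And>w. w \<in> X \<Longrightarrow> u w = v w + \<i> * of_real (2 * pi * of_int m)"
proof -
  let ?g = "\<lambda>w. u w - v w"
  have ex: "\<exists>m::int. ?g w = \<i> * of_real (2 * pi * of_int m)" if w: "w \<in> X" for w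
  proof -
    obtain m :: int where "u w = v w + (of_int (2 * m) * pi) * \<i>"
      using eq[OF w] unfolding exp_eq by auto
    then show ?thesis by (intro exI[of _ m]) (simp add: algebra_simps)
  qed
  have "?g constant_on X"
  proof (rule continuous_discrete_range_constant[OF assms(1)])
    show "continuous_on X ?g" by (intro continuous_intros assms)
    fix x assume x: "x \<in> X"
    have "2 * pi \<le> norm (?g y - ?g x)" if y: "y \<in> X" "?g y \<noteq> ?g x" for y
    proof -
      obtain m k :: int where mk: "?g x = \<i> * of_real (2 * pi * of_int m)" "?g y = \<i> * of_real (2 * pi * of_int k)"
        using ex x y(1) by metis
      have "?g y - ?g x = \<i> * of_real (2 * pi * of_int (k - m))"
        unfolding mk by (simp add: algebra_simps)
      then have nrm: "norm (?g y - ?g x) = 2 * pi * \<bar>of_int (k - m)\<bar>"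
        by (simp add: norm_mult abs_mult del: of_int_diff of_real_mult)
      have "k \<noteq> m" using y(2) mk by auto
      then have "1 \<le> \<bar>k - m\<bar>" by simp
      then have "1 \<le> \<bar>real_of_int (k - m)\<bar>" by linarith
      then have "2 * pi * 1 \<le> 2 * pi * \<bar>of_int (k - m)\<bar>" by (intro mult_left_mono) auto
      then show ?thesis using nrm by simp
    qed
    then show "\<exists>e>0. \<forall>y. y \<in> X \<and> ?g y \<noteq> ?g x \<longrightarrow> e \<le> norm (?g y - ?g x)"
      by (intro exI[of _ "2 * pi"]) auto
  qed
  then obtain y where y: "\<And>w. w \<in> X \<Longrightarrow> ?g w = y" unfolding constant_on_def by blast
  show thesis
  proof (cases "X = {}")
    case True
    then show ?thesis using that by simp
  next
    case False
    then obtain x where "x \<in> X" by blast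
    then obtain m :: int where m: "y = \<i> * of_real (2 * pi * of_int m)" using ex y by metis
    show ?thesis
    proof (rule that)
      fix w assume "w \<in> X"
      then show "u w = v w + \<i> * of_real (2 * pi * of_int m)"
        unfolding m[symmetric] using y[of w] by (simp add: algebra_simps)
    qed
  qed
qed

lemma shift_zero:
  fixes u :: "complex \<Rightarrow> complex" and c C \<tau> \<kappa> :: real
  assumes hol: "u holomorphic_on {w. Re w < c}" and \<tau>: "\<tau> > 0"
    and shift: "\<And>w. Re w < c \<Longrightarrow> u (w + \<i> * \<tau>) = u w + \<i> * \<kappa>"
    and bnd: "\<And>w. Re w < c \<Longrightarrow> \<bar>Re (u w)\<bar> \<le> C"
  shows "\<kappa> = 0"
proof -
  have "0 \<le> \<kappa>" by (rule shift_nonneg[OF hol \<tau> shift]) (use bnd abs_le_D1 in blast)+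
  moreover have "0 \<le> - \<kappa>"
  proof (rule shift_nonneg[of "\<lambda>w. - u w" c \<tau> "- \<kappa>" C])
    show "(\<lambda>w. - u w) holomorphic_on {w. Re w < c}" by (intro holomorphic_intros hol)
    show "Re (- u w) \<le> C" if "Re w < c" for w using bnd[OF that] by simp
  qed (use shift \<tau> in auto)
  ultimately show ?thesis by simp
qed

lemma poly_vimage_bounded:
  fixes P :: "complex poly"
  assumes "degree P > 0"
  obtains K where "K > 0" "\<And>z. norm (poly P z) \<le> C \<Longrightarrow> norm z < K"
proof -
  have "filterlim (poly P) at_infinity at_infinity"
    by (rule filterlim_poly_at_infinity[OF assms])
  then have "\<forall>\<^sub>F z in at_infinity. norm (poly P z) \<ge> max C 0 + 1"
    by (subst (asm) filterlim_at_infinity[of 0]) (auto simp: add_nonneg_pos)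
  then obtain K where K: "\<And>z. norm z \<ge> K \<Longrightarrow> norm (poly P z) \<ge> max C 0 + 1"
    by (auto simp: eventually_at_infinity)
  show thesis
  proof (rule that[of "max K 1"])
    fix z assume "norm (poly P z) \<le> C"
    then show "norm z < max K 1" using K[of z] by (cases "norm z \<ge> K") auto
  qed simp
qed

text \<open>In the coordinate \<open>w\<close>, a left half-plane covers a punctured neighbourhood of \<open>\<alpha>\<close>, a right
  half-plane a punctured neighbourhood of infinity, and a horizontal strip a sector with vertex
  \<open>\<alpha>\<close> that connects the two and misses \<open>bad\<close>.\<close>

locale poly_branches =
  fixes P :: "complex poly" and bad :: "complex set" and \<alpha> :: complex and \<theta> \<delta> M :: real
  assumes degP: "degree P > 0" and fin_bad: "finite bad"
    and crit: "poly P ` {z. poly (pderiv P) z = 0} \<subseteq> bad"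
    and \<delta>: "\<delta> > 0" and M: "M > 0"
    and ok: "\<And>w. Re w < - M \<or> Re w > M \<or> \<bar>Im w - \<theta>\<bar> < \<delta> \<Longrightarrow> \<alpha> + exp w \<notin> bad"

text \<open>\<open>\<theta>\<close> is a direction in which no bad point is seen from
  \<open>\<alpha>\<close>, and \<open>M\<close> exceeds the absolute logarithm of the distance of
  every bad point from \<open>\<alpha>\<close>.\<close>

lemma poly_branches_exist:
  fixes P :: "complex poly"
  assumes "degree P > 0" "finite bad" "poly P ` {z. poly (pderiv P) z = 0} \<subseteq> bad"
  obtains \<theta> \<delta> M where "poly_branches P bad \<alpha> \<theta> \<delta> M"
proof -
  \<comment> \<open>If \<open>\<alpha>\<close> itself is bad, it contributes the default values of
    \<open>Arg\<close> and \<open>ln\<close> at 0. This does no harm, since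
    \<open>\<alpha> + exp w\<close> never equals \<open>\<alpha>\<close>.\<close>
  let ?A = "(\<lambda>c. Arg (c - \<alpha>)) ` bad"
  have "infinite {- pi<..<pi}" by (simp add: infinite_Ioo)
  then obtain \<theta> where \<theta>: "\<theta> \<in> {- pi<..<pi} - ?A"
    using assms(2) by (metis Diff_infinite_finite ex_in_conv finite.emptyI finite_imageI)
  moreover have "open ({- pi<..<pi} - ?A)"
    using assms(2) by (intro open_Diff finite_imp_closed finite_imageI) auto
  ultimately obtain \<delta> where \<delta>: "\<delta> > 0" "\<And>y. \<bar>y - \<theta>\<bar> < \<delta> \<Longrightarrow> y \<in> {- pi<..<pi} - ?A"
    unfolding open_dist by (metis dist_real_def)
  obtain M0 where M0: "\<And>c. c \<in> bad \<Longrightarrow> \<bar>ln (norm (c - \<alpha>))\<bar> \<le> M0"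
    using finite_imp_bounded[OF finite_imageI[OF assms(2), of "\<lambda>c. ln (norm (c - \<alpha>))"]]
    unfolding bounded_iff by auto
  have "poly_branches P bad \<alpha> \<theta> \<delta> (\<bar>M0\<bar> + 1)"
  proof
    fix w assume w: "Re w < - (\<bar>M0\<bar> + 1) \<or> Re w > \<bar>M0\<bar> + 1 \<or> \<bar>Im w - \<theta>\<bar> < \<delta>"
    show "\<alpha> + exp w \<notin> bad"
    proof
      assume c: "\<alpha> + exp w \<in> bad"
      have "Im w \<notin> {- pi<..<pi} - ?A"
      proof
        assume im: "Im w \<in> {- pi<..<pi} - ?A"
        then have "Arg (exp w) = Im w" by (intro Arg_exp) auto
        then have "Im w \<in> ?A" using c by (force intro: image_eqI[of _ _ "\<alpha> + exp w"])
        then show False using im by blast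
      qed
      then have "\<not> \<bar>Im w - \<theta>\<bar> < \<delta>" using \<delta>(2) by blast
      moreover have "\<bar>Re w\<bar> \<le> M0" using M0[OF c] by simp
      ultimately show False using w by auto
    qed
  qed (use assms \<delta> in auto)
  then show thesis by (rule that)
qed

context poly_branches
begin

definition "f w = \<alpha> + exp w"
definition "E = {w. Re w < - M}"
definition "B = {w. Re w > M}"
definition "Strip = {w. \<bar>Im w - \<theta>\<bar> < \<delta>}"
definition "D = E \<union> Strip"
text \<open>The base point lies in the strip and in \<open>B\<close>, so the same roots
  \<open>Rts\<close> label the branches over \<open>D\<close> and those over
  \<open>B\<close>.\<close>

definition "w0 = Complex (M + 1) \<theta>"
definition "Rts = {z. poly P z = f w0}"

abbreviation "n \<equiv> degree P"

lemma f_notin: "w \<in> D \<union> B \<Longrightarrow> f w \<notin> bad"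
  using ok[of w] unfolding f_def D_def E_def B_def Strip_def by auto

lemma f_per [simp]: "f (w + per k) = f w" by (simp add: f_def)

lemma hol_f [holomorphic_intros]: "f holomorphic_on X"
  unfolding f_def by (intro holomorphic_intros)

lemma Strip_alt: "Strip = {w. Im w > \<theta> - \<delta>} \<inter> {w. Im w < \<theta> + \<delta>}"
  by (auto simp: Strip_def)

lemma convex_E: "convex E" and open_E: "open E" and convex_B: "convex B" and open_B: "open B"
  and convex_Strip: "convex Strip" and open_Strip: "open Strip" and open_D: "open D"
  unfolding D_def E_def B_def Strip_alt
  by (auto intro!: convex_halfspace_Re_lt convex_halfspace_Re_gt open_halfspace_Re_lt open_halfspace_Re_gt
      convex_Int open_Int open_Un convex_halfspace_Im_lt convex_halfspace_Im_gt
      open_halfspace_Im_lt open_halfspace_Im_gt)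

lemma w0_mem: "w0 \<in> D" "w0 \<in> B" "w0 \<in> Strip"
  using \<delta> M by (auto simp: w0_def D_def B_def Strip_def)

lemma starlike_D: "starlike D"
  unfolding starlike_def
proof (intro bexI ballI)
  \<comment> \<open>The star centre is a point common to the two convex pieces \<open>E\<close> and
    \<open>Strip\<close>.\<close>
  let ?a = "Complex (- M - 1) \<theta>"
  have aE: "?a \<in> E" and aS: "?a \<in> Strip" using \<delta> by (auto simp: E_def Strip_def)
  show "?a \<in> D" using aE by (simp add: D_def)
  fix x assume "x \<in> D"
  then consider "x \<in> E" | "x \<in> Strip" by (auto simp: D_def)
  then show "closed_segment ?a x \<subseteq> D"
    using closed_segment_subset[OF aE _ convex_E] closed_segment_subset[OF aS _ convex_Strip]
    by cases (auto simp: D_def)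
qed

lemma sc_D: "simply_connected D" and conn_D: "connected D"
  using starlike_D by (auto intro: starlike_imp_simply_connected starlike_imp_connected)

lemma fibre:
  assumes "f w \<notin> bad"
  shows "finite {z. poly P z = f w}" "card {z. poly P z = f w} = n"
    "rsquarefree (P - [:f w:])"
proof -
  have sq: "rsquarefree (P - [:f w:])"
    by (rule rsquarefree_diff_const) (use assms crit in blast)
  have eq: "{z. poly P z = f w} = {z. poly (P - [:f w:]) z = 0}" by simp
  show "card {z. poly P z = f w} = n" unfolding eq card_roots_rsquarefree[OF sq] by simp
  then show "finite {z. poly P z = f w}" using degP by (metis card.infinite less_irrefl)
  show "rsquarefree (P - [:f w:])" by (rule sq)
qed

lemma fin_Rts: "finite Rts" and card_Rts: "card Rts = n"
  unfolding Rts_def using fibre[of w0] f_notin w0_mem by auto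

text \<open>The choice is meaningful for an open simply connected \<open>X\<close> inside
  \<open>D \<union> B\<close> that contains \<open>w0\<close>, and for \<open>r\<close> in
  \<open>Rts\<close>. The branches \<open>p\<close> reach towards \<open>\<alpha>\<close>, the
  branches \<open>h\<close> live around infinity.\<close>

definition "lift X r = (SOME g. g holomorphic_on X \<and> g w0 = r \<and> (\<forall>w\<in>X. poly P (g w) = f w))"
abbreviation "p \<equiv> lift D"
abbreviation "h \<equiv> lift B"

lemma lift:
  assumes "open X" "simply_connected X" "w0 \<in> X" "X \<subseteq> D \<union> B" "r \<in> Rts"
  shows "lift X r holomorphic_on X" "lift X r w0 = r" "\<And>w. w \<in> X \<Longrightarrow> poly P (lift X r w) = f w"
proof -
  have "f \<in> X \<rightarrow> - bad" using assms(4) f_notin by blast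
  moreover have "poly P r = f w0" using assms(5) by (simp add: Rts_def)
  ultimately have "\<exists>g. g holomorphic_on X \<and> g w0 = r \<and> (\<forall>w\<in>X. poly P (g w) = f w)"
    using poly_lift_exists[OF degP fin_bad crit assms(1-3) hol_f] by metis
  from someI_ex[OF this]
  have "lift X r holomorphic_on X \<and> lift X r w0 = r \<and> (\<forall>w\<in>X. poly P (lift X r w) = f w)"
    unfolding lift_def .
  then show "lift X r holomorphic_on X" "lift X r w0 = r" "\<And>w. w \<in> X \<Longrightarrow> poly P (lift X r w) = f w"
    by auto
qed

lemmas p = lift[OF open_D sc_D w0_mem(1) Un_upper1]
lemmas h = lift[OF open_B convex_imp_simply_connected[OF convex_B] w0_mem(2) Un_upper2]

lemma lift_unique:
  assumes "connected X" "X \<subseteq> D \<union> B" "v \<in> X" "w \<in> X" "g holomorphic_on X" "k holomorphic_on X"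
    "\<And>w. w \<in> X \<Longrightarrow> poly P (g w) = f w" "\<And>w. w \<in> X \<Longrightarrow> poly P (k w) = f w" "g v = k v"
  shows "g w = k w"
proof (rule poly_lift_unique[OF degP fin_bad crit assms(1,3-6,9)])
  show "poly P (g w) \<notin> bad" if "w \<in> X" for w
    using assms(2,7) that f_notin by auto
qed (use assms in auto)

text \<open>Lifts that meet at one point coincide, so the \<open>n\<close> branches take
  \<open>n\<close> distinct values at each point and exhaust the fibre.\<close>

lemma lift_bij:
  assumes X: "open X" "simply_connected X" "w0 \<in> X" "X \<subseteq> D \<union> B" and w: "w \<in> X"
  shows "bij_betw (\<lambda>r. lift X r w) Rts {z. poly P z = f w}"
proof -
  have conn: "connected X" using X(2) by (rule simply_connected_imp_connected)
  have inj: "inj_on (\<lambda>r. lift X r w) Rts"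
  proof (rule inj_onI)
    fix r s assume rs: "r \<in> Rts" "s \<in> Rts" "lift X r w = lift X s w"
    have "lift X r w0 = lift X s w0"
      by (rule lift_unique[OF conn X(4) w X(3)]) (use rs lift[OF X] in auto)
    then show "r = s" using rs lift(2)[OF X] by simp
  qed
  have fw: "f w \<notin> bad" using f_notin w X(4) by blast
  have "(\<lambda>r. lift X r w) ` Rts = {z. poly P z = f w}"
  proof (rule card_seteq)
    show "(\<lambda>r. lift X r w) ` Rts \<subseteq> {z. poly P z = f w}" using lift(3)[OF X] w by auto
    show "card {z. poly P z = f w} \<le> card ((\<lambda>r. lift X r w) ` Rts)"
      using card_image[OF inj] card_Rts fibre(2)[OF fw] by simp
  qed (rule fibre(1)[OF fw])
  then show ?thesis using inj by (simp add: bij_betw_def)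
qed

lemmas p_bij = lift_bij[OF open_D sc_D w0_mem(1) Un_upper1]

lemma p_eq_h:
  assumes r: "r \<in> Rts" and w: "w \<in> Strip \<inter> B"
  shows "p r w = h r w"
proof (rule lift_unique[of "Strip \<inter> B" w0 w "p r" "h r"])
  show "connected (Strip \<inter> B)" by (intro convex_connected convex_Int convex_Strip convex_B)
  show "p r holomorphic_on Strip \<inter> B" by (rule holomorphic_on_subset[OF p(1)[OF r]]) (auto simp: D_def)
  show "h r holomorphic_on Strip \<inter> B" by (rule holomorphic_on_subset[OF h(1)[OF r]]) auto
qed (use r w p h w0_mem in \<open>auto simp: D_def\<close>)

lemma shift_mem [simp]: "w + per k \<in> E \<longleftrightarrow> w \<in> E" "w + per k \<in> B \<longleftrightarrow> w \<in> B"
  by (simp_all add: E_def B_def)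

lemma hol_shift:
  assumes "g holomorphic_on X" "\<And>w. w \<in> X \<Longrightarrow> w + per k \<in> X"
  shows "(\<lambda>w. g (w + per k)) holomorphic_on X"
proof -
  have "(\<lambda>w. w + per k) holomorphic_on X" by (intro holomorphic_intros)
  then show ?thesis
    using holomorphic_on_compose_gen[of "\<lambda>w. w + per k" X g X] assms by (auto simp: o_def)
qed

text \<open>Since \<open>f\<close> is invariant under full turns, \<open>g\<close> and its translate
  by \<open>per k\<close> lift the same function; they agree at the point \<open>v + per i\<close>
  and therefore everywhere.\<close>

lemma shift_coincide:
  assumes X: "X = E \<or> X = B" and g: "g holomorphic_on X" "\<And>w. w \<in> X \<Longrightarrow> poly P (g w) = f w"
    and v: "v \<in> X" and eq: "g (v + per i) = g (v + per (i + k))" and w: "w \<in> X"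
  shows "g (w + per k) = g w"
proof -
  have mem: "x + per j \<in> X \<longleftrightarrow> x \<in> X" for x j using X by auto
  show ?thesis
  proof (rule lift_unique[of X "v + per i" w "\<lambda>w. g (w + per k)" g])
    show "connected X" using X convex_E convex_B convex_connected by auto
    show "X \<subseteq> D \<union> B" using X by (auto simp: D_def)
    show "(\<lambda>w. g (w + per k)) holomorphic_on X" by (rule hol_shift[OF g(1)]) (simp add: mem)
    show "g (v + per i + per k) = g (v + per i)" using eq by (simp add: per_add add.assoc)
  qed (use g v w mem in auto)
qed

text \<open>Pigeonhole: the values after \<open>0\<close> to \<open>n\<close> turns are
  \<open>n + 1\<close> points in a fibre of size \<open>n\<close>.\<close>

lemma period_exists:
  assumes X: "X = E \<or> X = B" and g: "g holomorphic_on X" "\<And>w. w \<in> X \<Longrightarrow> poly P (g w) = f w"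
  obtains k where "1 \<le> k" "k \<le> n" "\<And>w. w \<in> X \<Longrightarrow> g (w + per k) = g w"
proof -
  have "Complex (- M - 1) 0 \<in> E" "Complex (M + 1) 0 \<in> B" by (auto simp: E_def B_def)
  then obtain v where v: "v \<in> X" using X by auto
  have mem: "x + per j \<in> X \<longleftrightarrow> x \<in> X" for x j using X by auto
  have fv: "f v \<notin> bad" using f_notin v X by (auto simp: D_def)
  let ?\<phi> = "\<lambda>j. g (v + per j)"
  have "?\<phi> ` {..n} \<subseteq> {z. poly P z = f v}" using g(2) v mem by auto
  then have "card (?\<phi> ` {..n}) \<le> n" using card_mono[OF fibre(1)[OF fv]] fibre(2)[OF fv] by metis
  then have "\<not> inj_on ?\<phi> {..n}" using card_image by fastforce
  then obtain i j where ij: "i \<le> n" "j \<le> n" "i < j" "?\<phi> i = ?\<phi> j"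
    unfolding inj_on_def by (metis atMost_iff linorder_neqE_nat)
  show thesis
  proof (rule that[of "j - i"])
    show "g (w + per (j - i)) = g w" if "w \<in> X" for w
      by (rule shift_coincide[OF X g v _ that, of i]) (use ij in auto)
  qed (use ij in auto)
qed

lemma period_mult:
  assumes "\<And>w. w \<in> X \<Longrightarrow> w + per k \<in> X" "\<And>w. w \<in> X \<Longrightarrow> g (w + per k) = g w" "w \<in> X"
  shows "g (w + per (j * k)) = g w"
proof -
  have "w + per (j * k) \<in> X \<and> g (w + per (j * k)) = g w"
  proof (induction j)
    case (Suc j)
    have eq: "w + per (Suc j * k) = (w + per (j * k)) + per k"
      by (simp add: per_add algebra_simps)
    show ?case unfolding eq using Suc assms by metis
  qed (use assms in simp)
  then show ?thesis by blast
qed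

text \<open>Every branch has a period of at most \<open>n\<close> turns, so \<open>n!\<close> turns are a common period.\<close>

definition "N = (fact n :: nat)"

lemma N_pos: "N > 0" by (simp add: N_def)

lemma p_period:
  assumes r: "r \<in> Rts" and w: "w \<in> E"
  shows "p r (w + per N) = p r w"
proof -
  have hol: "p r holomorphic_on E" by (rule holomorphic_on_subset[OF p(1)[OF r]]) (simp add: D_def)
  obtain k where k: "1 \<le> k" "k \<le> n" "\<And>w. w \<in> E \<Longrightarrow> p r (w + per k) = p r w"
    by (rule period_exists[of E "p r"]) (use hol p(3)[OF r] in \<open>auto simp: D_def\<close>)
  then have "k dvd N" by (simp add: N_def dvd_fact)
  then obtain j where "N = j * k" by (metis dvdE mult.commute)
  then show ?thesis using period_mult[of E k "p r" w j] k(3) w by auto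
qed

text \<open>The factorisation of \<open>P - [:f w:]\<close> evaluated at \<open>c\<close>. The
  right-hand side no longer involves the branches, which lets the sum of their logarithms be
  estimated.\<close>

lemma fibre_norm_prod:
  assumes w: "w \<in> D"
  shows "(\<Prod>r\<in>Rts. norm (p r w - c)) = norm (poly P c - f w) / norm (lead_coeff P)"
proof -
  have fw: "f w \<notin> bad" using f_notin w by blast
  have lc: "lead_coeff (P - [:f w:]) = lead_coeff P"
    using degP by (cases n) (simp_all)
  have "P - [:f w:] = smult (lead_coeff P) (\<Prod>z | poly P z = f w. [:-z, 1:])"
    using complex_poly_decompose_rsquarefree[OF fibre(3)[OF fw]] unfolding lc by simp
  then have "poly (P - [:f w:]) c = poly (smult (lead_coeff P) (\<Prod>z | poly P z = f w. [:-z, 1:])) c"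
    by (rule arg_cong)
  then have "poly P c - f w = lead_coeff P * (\<Prod>z | poly P z = f w. c - z)"
    by (simp add: poly_prod)
  also have "(\<Prod>z | poly P z = f w. c - z) = (\<Prod>r\<in>Rts. c - p r w)"
    by (rule prod.reindex_bij_betw[OF p_bij[OF w], symmetric])
  finally have "norm (poly P c - f w) = norm (lead_coeff P) * (\<Prod>r\<in>Rts. norm (p r w - c))"
    by (simp add: norm_mult norm_minus_commute flip: prod_norm)
  moreover have "lead_coeff P \<noteq> 0" using degP by auto
  ultimately show ?thesis by simp
qed

lemma fibre_sum:
  assumes "w \<in> D"
  shows "(\<Sum>z | poly P z = f w. F z) = (\<Sum>r\<in>Rts. F (p r w))"
  by (rule sum.reindex_bij_betw[OF p_bij[OF assms], symmetric])

lemma log_exists: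
  assumes "r \<in> Rts" "poly P c \<in> bad"
  obtains g m where "g holomorphic_on D" "\<And>w. w \<in> D \<Longrightarrow> exp (g w) = p r w - c"
    "\<And>w. w \<in> E \<Longrightarrow> g (w + per N) = g w + \<i> * of_real (2 * pi * of_int m)"
proof -
  have nz: "p r w - c \<noteq> 0" if "w \<in> D" for w
    using p(3)[OF assms(1) that] f_notin[of w] assms(2) that by auto
  have hol: "(\<lambda>w. p r w - c) holomorphic_on D" by (intro holomorphic_intros p assms)
  obtain g where l: "g holomorphic_on D" "\<And>w. w \<in> D \<Longrightarrow> p r w - c = exp (g w)"
    by (rule simply_connected_imp_holomorphic_log[OF hol sc_D open_imp_locally_path_connected[OF open_D] nz]) auto
  have ED: "E \<subseteq> D" by (simp add: D_def)
  have holE: "g holomorphic_on E" by (rule holomorphic_on_subset[OF l(1) ED])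
  have "\<exists>m::int. \<forall>w\<in>E. g (w + per N) = g w + \<i> * of_real (2 * pi * of_int m)"
  proof -
    have 1: "connected E" by (rule convex_connected[OF convex_E])
    have 2: "continuous_on E (\<lambda>w. g (w + per N))"
      by (rule holomorphic_on_imp_continuous_on[OF hol_shift[OF holE]]) simp
    have 3: "continuous_on E g" by (rule holomorphic_on_imp_continuous_on[OF holE])
    have 4: "exp (g (w + per N)) = exp (g w)" if "w \<in> E" for w
    proof -
      have "w \<in> D" "w + per N \<in> D" using that ED shift_mem(1) by blast+
      then show ?thesis using l(2) p_period[OF assms(1) that] by metis
    qed
    from exp_eq_imp_diff_const[OF 1 2 3 4] show ?thesis by metis
  qed
  then show thesis using that l by metis
qed

text \<open>\<open>winding c r\<close> is the winding number about \<open>c\<close> of the branch \<open>p r\<close> along \<open>N\<close> turns of the parameter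
  around \<open>\<alpha>\<close>. Both choices are meaningful only for \<open>poly P c \<in> bad\<close>, which makes \<open>p r - c\<close> zero-free.\<close>

definition "is_log c r g m \<longleftrightarrow> g holomorphic_on D \<and> (\<forall>w\<in>D. exp (g w) = p r w - c) \<and>
  (\<forall>w\<in>E. g (w + per N) = g w + \<i> * of_real (2 * pi * of_int m))"
definition "branch_log c r = fst (SOME (g, m). is_log c r g m)"
definition "winding c r = snd (SOME (g, m). is_log c r g m)"

lemma branch_log:
  assumes "r \<in> Rts" "poly P c \<in> bad"
  shows "branch_log c r holomorphic_on D" "\<And>w. w \<in> D \<Longrightarrow> exp (branch_log c r w) = p r w - c"
    "\<And>w. w \<in> E \<Longrightarrow> branch_log c r (w + per N) = branch_log c r w + \<i> * of_real (2 * pi * of_int (winding c r))"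
proof -
  obtain g m where "is_log c r g m" using log_exists[OF assms] unfolding is_log_def by metis
  then have "case (g, m) of (g, m) \<Rightarrow> is_log c r g m" by simp
  then have "case (SOME (g, m). is_log c r g m) of (g, m) \<Rightarrow> is_log c r g m" by (rule someI)
  then have "is_log c r (branch_log c r) (winding c r)" unfolding branch_log_def winding_def by (simp add: case_prod_beta)
  then show "branch_log c r holomorphic_on D" "\<And>w. w \<in> D \<Longrightarrow> exp (branch_log c r w) = p r w - c"
    "\<And>w. w \<in> E \<Longrightarrow> branch_log c r (w + per N) = branch_log c r w + \<i> * of_real (2 * pi * of_int (winding c r))"
    unfolding is_log_def by auto
qed

lemma Re_branch_log:
  assumes "r \<in> Rts" "poly P c \<in> bad" "w \<in> D"
  shows "exp (Re (branch_log c r w)) = norm (p r w - c)"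
  using branch_log(2)[OF assms] by (metis norm_exp_eq_Re)

section \<open>Winding numbers of the branches near \<alpha>\<close>

lemma p_bounded:
  obtains K where "K > 0" "\<And>r w. r \<in> Rts \<Longrightarrow> w \<in> E \<Longrightarrow> norm (p r w) < K"
proof -
  obtain K where K: "K > 0" "\<And>z. norm (poly P z) \<le> norm \<alpha> + 1 \<Longrightarrow> norm z < K"
    using poly_vimage_bounded[OF degP, of "norm \<alpha> + 1"] by blast
  show thesis
  proof (rule that[OF K(1)])
    fix r w assume r: "r \<in> Rts" and w: "w \<in> E"
    have "norm (poly P (p r w)) = norm (\<alpha> + exp w)"
      using p(3)[OF r, of w] w by (simp add: D_def f_def)
    also have "\<dots> \<le> norm \<alpha> + norm (exp w)" by (rule norm_triangle_ineq)
    also have "norm (exp w) \<le> 1" using w M by (simp add: E_def norm_exp_eq_Re)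
    finally show "norm (p r w) < K" by (intro K(2)) simp
  qed
qed

lemma branch_log_shift:
  assumes "r \<in> Rts" "poly P c \<in> bad" "w \<in> E"
  shows "branch_log c r (w + \<i> * of_real (2 * pi * real N)) = branch_log c r w + \<i> * of_real (2 * pi * of_int (winding c r))"
  using branch_log(3)[OF assms] by (simp only: per_def)

lemma tau_pos: "2 * pi * real N > 0" using N_pos by simp

text \<open>Over \<open>E\<close> the branches are bounded, so the real part of
  \<open>branch_log c r\<close>, which is the logarithm of the distance to \<open>c\<close>, is
  bounded above and \<open>shift_nonneg\<close> applies.\<close>

lemma winding_nonneg:
  assumes r: "r \<in> Rts" and c: "poly P c \<in> bad"
  shows "winding c r \<ge> 0"
proof -
  obtain K where K: "K > 0" "\<And>r w. r \<in> Rts \<Longrightarrow> w \<in> E \<Longrightarrow> norm (p r w) < K"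
    using p_bounded by blast
  have "0 \<le> 2 * pi * real_of_int (winding c r)"
  proof (rule shift_nonneg[of "branch_log c r" "- M" "2 * pi * real N" _ "ln (K + norm c)"])
    show "branch_log c r holomorphic_on {w. Re w < - M}"
      by (rule holomorphic_on_subset[OF branch_log(1)[OF r c]]) (auto simp: D_def E_def)
    fix w assume "Re w < - M"
    then have w: "w \<in> E" by (simp add: E_def)
    show "branch_log c r (w + \<i> * of_real (2 * pi * real N)) = branch_log c r w + \<i> * of_real (2 * pi * real_of_int (winding c r))"
      by (rule branch_log_shift[OF r c w])
    have "exp (Re (branch_log c r w)) = norm (p r w - c)" by (rule Re_branch_log[OF r c]) (use w in \<open>simp add: D_def\<close>)
    also have "\<dots> \<le> norm (p r w) + norm c" by (rule norm_triangle_ineq4)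
    also have "\<dots> \<le> K + norm c" using K(2)[OF r w] by simp
    finally show "Re (branch_log c r w) \<le> ln (K + norm c)"
      using K(1) by (simp add: ln_ge_iff add_pos_nonneg)
  qed (rule tau_pos)
  moreover have "2 * pi * real_of_int (winding c r) < 0" if "winding c r < 0"
    using that by (intro mult_pos_neg) auto
  ultimately show ?thesis by linarith
qed

text \<open>If the branch keeps away from \<open>c\<close>, its logarithm is also bounded below in
  real part, so \<open>shift_nonneg\<close> applied to \<open>- branch_log c r\<close> excludes a
  positive winding.\<close>

lemma winding_zero:
  assumes r: "r \<in> Rts" and c: "poly P c \<in> bad" and \<epsilon>: "\<epsilon> > 0" and \<mu>: "\<mu> \<ge> M"
    and far: "\<And>w. Re w < - \<mu> \<Longrightarrow> \<epsilon> \<le> norm (p r w - c)"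
  shows "winding c r = 0"
proof -
  have "0 \<le> - (2 * pi * real_of_int (winding c r))"
  proof (rule shift_nonneg[of "\<lambda>w. - branch_log c r w" "- \<mu>" "2 * pi * real N" _ "- ln \<epsilon>"])
    show "(\<lambda>w. - branch_log c r w) holomorphic_on {w. Re w < - \<mu>}"
      by (intro holomorphic_intros holomorphic_on_subset[OF branch_log(1)[OF r c]])
        (use \<mu> in \<open>auto simp: D_def E_def\<close>)
    fix w assume wr: "Re w < - \<mu>"
    then have w: "w \<in> E" using \<mu> by (simp add: E_def)
    show "- branch_log c r (w + \<i> * of_real (2 * pi * real N)) = - branch_log c r w + \<i> * of_real (- (2 * pi * real_of_int (winding c r)))"
      using branch_log_shift[OF r c w] by (simp del: of_real_mult)
    have "exp (Re (branch_log c r w)) = norm (p r w - c)" by (rule Re_branch_log[OF r c]) (use w in \<open>simp add: D_def\<close>)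
    then have "\<epsilon> \<le> exp (Re (branch_log c r w))" using far[OF wr] by simp
    then have "ln \<epsilon> \<le> Re (branch_log c r w)" using \<epsilon> by (metis ln_exp ln_le_cancel_iff exp_gt_zero)
    then show "Re (- branch_log c r w) \<le> - ln \<epsilon>" by simp
  qed (rule tau_pos)
  moreover have "0 < 2 * pi * real_of_int (winding c r)" if "0 < winding c r" using that by simp
  ultimately have "winding c r \<le> 0" by linarith
  then show ?thesis using winding_nonneg[OF r c] by simp
qed

text \<open>The branch logarithms add up to a logarithm of a constant multiple of
  \<open>P(c) - f w\<close>. If \<open>P(c) = \<alpha>\<close>, this is a multiple of
  \<open>exp w\<close> and turns \<open>N\<close> times; otherwise it has a non-zero limit and does
  not turn.\<close>

lemma winding_sum:
  assumes c: "poly P c \<in> bad"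
  shows "(\<Sum>r\<in>Rts. winding c r) = (if poly P c = \<alpha> then int N else 0)"
proof -
  define \<sigma> :: real where "\<sigma> = (if poly P c = \<alpha> then 1 else 0)"
  define d where "d = norm (poly P c - \<alpha>)"
  define L where "L = norm (lead_coeff P)"
  have L: "L > 0" unfolding L_def using degP by auto
  \<comment> \<open>Subtracting \<open>\<sigma> * w\<close> removes the turning of
    \<open>exp w\<close>; what remains has bounded real part, as \<open>shift_zero\<close>
    requires.\<close>
  define u where "u w = (\<Sum>r\<in>Rts. branch_log c r w) - of_real \<sigma> * w" for w
  define \<mu> where "\<mu> = max M (if poly P c = \<alpha> then M else - ln (d / 2))"
  have \<mu>: "\<mu> \<ge> M" by (simp add: \<mu>_def)
  obtain C1 C2 where C: "C1 > 0" "C2 > 0"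
    and bnd: "\<And>w. Re w < - \<mu> \<Longrightarrow> C1 \<le> exp (Re (u w)) \<and> exp (Re (u w)) \<le> C2"
  proof -
    have eq: "exp (Re (u w)) = norm (poly P c - f w) / L / exp (\<sigma> * Re w)" if "Re w < - \<mu>" for w
    proof -
      have w: "w \<in> D" using that \<mu> by (simp add: D_def E_def)
      have "exp (Re (u w)) = (\<Prod>r\<in>Rts. exp (Re (branch_log c r w))) / exp (\<sigma> * Re w)"
        by (simp add: u_def exp_diff exp_sum fin_Rts)
      also have "(\<Prod>r\<in>Rts. exp (Re (branch_log c r w))) = (\<Prod>r\<in>Rts. norm (p r w - c))"
        using Re_branch_log[OF _ c w] by simp
      finally show ?thesis using fibre_norm_prod[OF w, of c] by (simp add: L_def)
    qed
    show thesis
    proof (cases "poly P c = \<alpha>")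
      case True
      show thesis
        by (rule that[of "1 / L" "1 / L"]) (use L True in \<open>simp_all add: eq \<sigma>_def f_def norm_exp_eq_Re\<close>)
    next
      case False
      then have d: "d > 0" by (simp add: d_def)
      show thesis
      proof (rule that[of "d / 2 / L" "(d + d / 2) / L"])
        fix w assume w: "Re w < - \<mu>"
        have "exp (Re w) \<le> exp (ln (d / 2))" using w False by (simp add: \<mu>_def)
        then have "norm (exp w) \<le> d / 2" using d by (simp add: norm_exp_eq_Re)
        moreover have "norm (poly P c - f w) = norm ((poly P c - \<alpha>) - exp w)" by (simp add: f_def algebra_simps)
        ultimately have "norm (poly P c - f w) \<le> d + d / 2" "d / 2 \<le> norm (poly P c - f w)"
          using norm_triangle_ineq4[of "poly P c - \<alpha>" "exp w"] norm_triangle_ineq2[of "poly P c - \<alpha>" "exp w"]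
          unfolding d_def by linarith+
        then show "d / 2 / L \<le> exp (Re (u w)) \<and> exp (Re (u w)) \<le> (d + d / 2) / L"
          unfolding eq[OF w] using L False by (auto simp: \<sigma>_def intro!: divide_right_mono simp del: divide_divide_eq_left)
      qed (use d L in auto)
    qed
  qed
  have "2 * pi * (real_of_int (\<Sum>r\<in>Rts. winding c r) - \<sigma> * real N) = 0"
  proof (rule shift_zero[of u "- \<mu>" "2 * pi * real N" _ "max \<bar>ln C1\<bar> \<bar>ln C2\<bar>"])
    show "u holomorphic_on {w. Re w < - \<mu>}" unfolding u_def
      by (intro holomorphic_intros holomorphic_on_subset[OF branch_log(1)[OF _ c]])
        (use \<mu> in \<open>auto simp: D_def E_def\<close>)
    fix w assume wr: "Re w < - \<mu>"
    then have w: "w \<in> E" using \<mu> by (simp add: E_def)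
    have "(\<Sum>r\<in>Rts. branch_log c r (w + \<i> * of_real (2 * pi * real N)))
      = (\<Sum>r\<in>Rts. branch_log c r w + \<i> * of_real (2 * pi * of_int (winding c r)))"
      by (intro sum.cong branch_log_shift c w refl)
    then show "u (w + \<i> * of_real (2 * pi * real N))
        = u w + \<i> * of_real (2 * pi * (real_of_int (\<Sum>r\<in>Rts. winding c r) - \<sigma> * real N))"
      unfolding u_def by (simp add: sum.distrib sum_distrib_left algebra_simps)
    have "ln C1 \<le> Re (u w)" "Re (u w) \<le> ln C2"
      using bnd[OF wr] C by (simp_all add: ln_ge_iff) (metis exp_gt_zero ln_exp ln_le_cancel_iff)
    then show "\<bar>Re (u w)\<bar> \<le> max \<bar>ln C1\<bar> \<bar>ln C2\<bar>" by linarith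
  qed (rule tau_pos)
  then have "real_of_int (\<Sum>r\<in>Rts. winding c r) = real_of_int (if poly P c = \<alpha> then int N else 0)"
    by (simp add: \<sigma>_def del: of_int_sum)
  then show ?thesis by (simp only: of_int_eq_iff)
qed

text \<open>On a small circle about \<open>c\<close> that misses the preimages of
  \<open>\<alpha>\<close>, \<open>P\<close> keeps a distance \<open>\<eta>\<close> from
  \<open>\<alpha>\<close>. Once \<open>f w\<close> is closer than that, the branch cannot meet the
  circle, so its connected image is either inside or outside; outside would make the winding
  zero.\<close>

lemma winding_limit:
  assumes r: "r \<in> Rts" and c: "poly P c \<in> bad" and Pc: "poly P c = \<alpha>" and pos: "winding c r > 0" and \<epsilon>: "\<epsilon> > 0"
  obtains \<mu> where "\<mu> \<ge> M" "\<And>w. Re w < - \<mu> \<Longrightarrow> norm (p r w - c) < \<epsilon>"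
proof -
  have "finite {z. poly P z = \<alpha>}"
  proof -
    have "P - [:\<alpha>:] \<noteq> 0" using degP by (metis degree_pCons_0 eq_iff_diff_eq_0 less_irrefl)
    then have "finite {z. poly (P - [:\<alpha>:]) z = 0}" by (rule poly_roots_finite)
    then show ?thesis by simp
  qed
  then have "finite ((\<lambda>z. norm (z - c)) ` {z. poly P z = \<alpha>})" by (rule finite_imageI)
  moreover have "infinite {0<..<\<epsilon>}" using \<epsilon> by (simp add: infinite_Ioo)
  ultimately obtain e where e: "e \<in> {0<..<\<epsilon>} - (\<lambda>z. norm (z - c)) ` {z. poly P z = \<alpha>}"
    by (metis Diff_infinite_finite ex_in_conv finite.emptyI)
  have "compact (sphere c e)" "sphere c e \<noteq> {}" using e by auto
  moreover have "continuous_on (sphere c e) (\<lambda>z. norm (poly P z - \<alpha>))" by (intro continuous_intros)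
  ultimately obtain z0 where z0: "z0 \<in> sphere c e"
    "\<And>z. z \<in> sphere c e \<Longrightarrow> norm (poly P z0 - \<alpha>) \<le> norm (poly P z - \<alpha>)"
    using continuous_attains_inf by metis
  define \<eta> where "\<eta> = norm (poly P z0 - \<alpha>)"
  have "norm (z0 - c) = e" using z0(1) by (simp add: dist_norm norm_minus_commute)
  then have \<eta>: "\<eta> > 0" using e by (auto simp: \<eta>_def)
  define \<mu> where "\<mu> = max M (- ln \<eta>)"
  let ?H = "{w. Re w < - \<mu>}"
  have HD: "?H \<subseteq> D" by (auto simp: \<mu>_def D_def E_def)
  have conn: "connected (p r ` ?H)"
    by (intro connected_continuous_image convex_connected convex_halfspace_Re_lt
        continuous_on_subset[OF holomorphic_on_imp_continuous_on[OF p(1)[OF r]] HD])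
  have avoid: "p r ` ?H \<inter> sphere c e = {}"
  proof -
    have False if w: "w \<in> ?H" and s: "p r w \<in> sphere c e" for w
    proof -
      have "\<eta> \<le> norm (poly P (p r w) - \<alpha>)" unfolding \<eta>_def by (rule z0(2)[OF s])
      also have "\<dots> = exp (Re w)" using p(3)[OF r, of w] HD w by (auto simp: f_def norm_exp_eq_Re)
      also have "\<dots> < exp (ln \<eta>)" using w by (auto simp: \<mu>_def)
      finally show False using \<eta> by simp
    qed
    then show ?thesis by blast
  qed
  have "\<exists>w\<in>?H. norm (p r w - c) < e"
  proof (rule ccontr)
    assume "\<not> ?thesis"
    then have "\<And>w. Re w < - \<mu> \<Longrightarrow> e \<le> norm (p r w - c)" by force
    then have "winding c r = 0" using winding_zero[OF r c, of e \<mu>] e by (auto simp: \<mu>_def)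
    then show False using pos by simp
  qed
  then have inter: "p r ` ?H \<inter> ball c e \<noteq> {}" by (auto simp: dist_norm norm_minus_commute)
  have sub: "p r ` ?H \<subseteq> ball c e"
  proof (rule ccontr)
    assume "\<not> ?thesis"
    then have "p r ` ?H - ball c e \<noteq> {}" by blast
    from connected_Int_frontier[OF conn inter this] show False
      using avoid e by (simp add: frontier_ball)
  qed
  show thesis
  proof (rule that)
    show "M \<le> \<mu>" by (simp add: \<mu>_def)
    fix w assume "Re w < - \<mu>"
    then have "p r w \<in> ball c e" using sub by blast
    then show "norm (p r w - c) < \<epsilon>" using e by (simp add: dist_norm norm_minus_commute)
  qed
qed

text \<open>\<open>P\<close> is injective near the regular point \<open>a\<close>, so two branches
  tending to \<open>a\<close> coincide. A single branch therefore carries the whole sum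
  \<open>N\<close>.\<close>

lemma winding_simple:
  assumes a: "poly P a \<in> bad" and Pa: "poly P a = \<alpha>" and reg: "poly (pderiv P) a \<noteq> 0"
  obtains s0 where "s0 \<in> Rts" "\<And>r. r \<in> Rts \<Longrightarrow> winding a r = (if r = s0 then int N else 0)"
proof -
  have uniq: "r = s" if rs: "r \<in> Rts" "s \<in> Rts" "winding a r > 0" "winding a s > 0" for r s
  proof -
    have "deriv (poly P) a \<noteq> 0" using reg by (simp add: DERIV_imp_deriv[OF poly_DERIV])
    moreover have "poly P holomorphic_on UNIV" by (intro holomorphic_intros)
    ultimately obtain \<rho> where \<rho>: "\<rho> > 0" "inj_on (poly P) (ball a \<rho>)"
      using has_complex_derivative_locally_injective[of "poly P" UNIV a] by auto
    obtain \<mu>1 where m1: "\<mu>1 \<ge> M" "\<And>w. Re w < - \<mu>1 \<Longrightarrow> norm (p r w - a) < \<rho>"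
      using winding_limit[OF rs(1) a Pa rs(3) \<rho>(1)] by blast
    obtain \<mu>2 where m2: "\<mu>2 \<ge> M" "\<And>w. Re w < - \<mu>2 \<Longrightarrow> norm (p s w - a) < \<rho>"
      using winding_limit[OF rs(2) a Pa rs(4) \<rho>(1)] by blast
    define w where "w = Complex (- (max \<mu>1 \<mu>2) - 1) 0"
    have wD: "w \<in> D" using m1(1) by (auto simp: w_def D_def E_def)
    have "p r w \<in> ball a \<rho>" "p s w \<in> ball a \<rho>"
      using m1(2)[of w] m2(2)[of w] by (auto simp: w_def dist_norm norm_minus_commute)
    then have "p r w = p s w"
      using \<rho>(2) p(3)[OF rs(1) wD] p(3)[OF rs(2) wD] by (metis inj_onD)
    then show "r = s" using p_bij[OF wD] rs(1,2) unfolding bij_betw_def by (metis (mono_tags) inj_onD)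
  qed
  have sum: "(\<Sum>r\<in>Rts. winding a r) = int N" using winding_sum[OF a] Pa by simp
  obtain s0 where s0: "s0 \<in> Rts" "winding a s0 > 0"
  proof (rule ccontr)
    assume "\<not> thesis"
    then have "\<forall>r\<in>Rts. winding a r = 0" using that winding_nonneg[OF _ a] by force
    then show False using sum N_pos by simp
  qed
  have zero: "winding a r = 0" if "r \<in> Rts" "r \<noteq> s0" for r
    using uniq[OF that(1) s0(1) _ s0(2)] winding_nonneg[OF that(1) a] that(2) by force
  have "(\<Sum>r\<in>Rts. winding a r) = winding a s0 + (\<Sum>r\<in>Rts - {s0}. winding a r)"
    by (rule sum.remove[OF fin_Rts s0(1)])
  also have "(\<Sum>r\<in>Rts - {s0}. winding a r) = 0" using zero by (intro sum.neutral) auto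
  finally have "winding a s0 = int N" using sum by simp
  then show thesis using that[OF s0(1)] zero by auto
qed

end

subsection \<open>Monodromy at infinity\<close>

text \<open>Each inner product of \<open>x r\<close> with \<open>y\<close> is at most that of
  \<open>y\<close> with itself, so the mean forces equality wherever the weight is positive.
  Combined with \<open>norm (x s) \<le> norm y\<close> this makes the squared distance of
  \<open>x s\<close> and \<open>y\<close> non-positive.\<close>

lemma weighted_mean_extreme:
  fixes y :: complex and x :: "'a \<Rightarrow> complex" and m :: "'a \<Rightarrow> real"
  assumes fin: "finite R" and m: "\<And>r. r \<in> R \<Longrightarrow> 0 \<le> m r" and le: "\<And>r. r \<in> R \<Longrightarrow> norm (x r) \<le> norm y"
    and eq: "of_real (\<Sum>r\<in>R. m r) * y = (\<Sum>r\<in>R. of_real (m r) * x r)" and s: "s \<in> R" "m s > 0"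
  shows "x s = y"
proof -
  have le2: "x r \<bullet> y \<le> y \<bullet> y" if "r \<in> R" for r
  proof -
    have "x r \<bullet> y \<le> norm (x r) * norm y" by (rule norm_cauchy_schwarz)
    also have "\<dots> \<le> norm y * norm y" using le[OF that] by (intro mult_right_mono) auto
    finally show ?thesis by (simp add: dot_square_norm power2_eq_square)
  qed
  have "(of_real (\<Sum>r\<in>R. m r) * y) \<bullet> y = (\<Sum>r\<in>R. of_real (m r) * x r) \<bullet> y" using eq by simp
  then have "(\<Sum>r\<in>R. m r * (y \<bullet> y - x r \<bullet> y)) = 0"
    by (simp add: scaleR_conv_of_real[symmetric] inner_sum_left sum_distrib_right sum_subtractf right_diff_distrib)
  then have "m s * (y \<bullet> y - x s \<bullet> y) = 0"
    using sum_nonneg_eq_0_iff[OF fin, of "\<lambda>r. m r * (y \<bullet> y - x r \<bullet> y)"] m le2 s(1) by auto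
  then have xy: "x s \<bullet> y = y \<bullet> y" using s(2) by simp
  have "(x s - y) \<bullet> (x s - y) = x s \<bullet> x s - 2 * (x s \<bullet> y) + y \<bullet> y"
    by (simp add: inner_diff_left inner_diff_right inner_commute)
  also have "\<dots> = (norm (x s))\<^sup>2 - (norm y)\<^sup>2" using xy by (simp add: dot_square_norm)
  also have "\<dots> \<le> 0" using le[OF s(1)] by (simp add: power_mono)
  finally show ?thesis by (metis antisym inner_ge_zero inner_eq_zero_iff eq_iff_diff_eq_0)
qed

text \<open>Holomorphic functions on a connected open set have no zero divisors: where one factor is
  non-zero the remaining product vanishes, hence everywhere by the identity theorem.\<close>

lemma holomorphic_prod_eq_0:
  fixes F :: "'a \<Rightarrow> complex \<Rightarrow> complex"
  assumes "finite J" and X: "open X" "connected X" "X \<noteq> {}"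
    and "\<And>j. j \<in> J \<Longrightarrow> F j holomorphic_on X" and "\<And>w. w \<in> X \<Longrightarrow> (\<Prod>j\<in>J. F j w) = 0"
  shows "\<exists>j\<in>J. \<forall>w\<in>X. F j w = 0"
  using assms(1,5,6)
proof (induction J rule: finite_induct)
  case empty
  then show ?case using X(3) by auto
next
  case (insert j J)
  show ?case
  proof (cases "\<forall>w\<in>X. F j w = 0")
    case False
    then obtain x where x: "x \<in> X" "F j x \<noteq> 0" by blast
    let ?U = "{w \<in> X. F j w \<noteq> 0}"
    have "continuous_on X (F j)" using insert.prems(1) by (intro holomorphic_on_imp_continuous_on) simp
    then have "open (X \<inter> F j -` (- {0}))" using X(1) by (intro continuous_open_preimage) auto
    moreover have "?U = X \<inter> F j -` (- {0})" by auto
    ultimately have openU: "open ?U" by simp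
    have "(\<Prod>i\<in>J. F i w) = 0" if "w \<in> X" for w
    proof (rule analytic_continuation_open[of ?U X "\<lambda>w. \<Prod>i\<in>J. F i w" "\<lambda>_. 0"])
      show "(\<lambda>w. \<Prod>i\<in>J. F i w) holomorphic_on X"
        using insert.prems(1) by (intro holomorphic_intros) auto
      show "(\<Prod>i\<in>J. F i z) = 0" if "z \<in> ?U" for z
        using insert.prems(2)[of z] insert.hyps that by simp
    qed (use x X openU that in auto)
    then show ?thesis using insert.IH insert.prems(1) by blast
  qed auto
qed

lemma poly_growth:
  fixes P :: "complex poly"
  assumes "degree P > 0"
  obtains K where "K > 0" "\<And>z. K \<le> norm z \<Longrightarrow> norm (lead_coeff P) / 2 \<le> norm (poly P z / z ^ degree P)"
    "\<And>z. K \<le> norm z \<Longrightarrow> norm (poly P z / z ^ degree P) \<le> 2 * norm (lead_coeff P)"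
proof -
  let ?l = "norm (lead_coeff P)"
  have l: "?l > 0" using assms by auto
  have "((\<lambda>z. norm (poly P z / z ^ degree P)) \<longlongrightarrow> ?l) at_infinity"
    by (intro tendsto_norm poly_divide_tendsto_aux)
  then have "\<forall>\<^sub>F z in at_infinity. norm (poly P z / z ^ degree P) \<in> {?l / 2 <..< 2 * ?l}"
    by (rule topological_tendstoD) (use l in auto)
  then obtain K where K: "\<And>z. K \<le> norm z \<Longrightarrow> norm (poly P z / z ^ degree P) \<in> {?l / 2 <..< 2 * ?l}"
    by (auto simp: eventually_at_infinity)
  show thesis
    by (rule that[of "max K 1"]) (use K in \<open>auto simp: less_imp_le\<close>)
qed

context poly_branches
begin

text \<open>Near infinity a branch behaves like \<open>exp (w / n)\<close>, so its period under \<open>w \<mapsto> w + 2 \<pi> \<i>\<close>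
  is a multiple of \<open>n\<close>: the monodromy at infinity permutes the branches cyclically.\<close>

lemma h_period:
  assumes r: "r \<in> Rts" and per: "\<And>w. w \<in> B \<Longrightarrow> h r (w + per k) = h r w"
  shows "int n dvd int k"
proof -
  let ?P = "P - [:\<alpha>:]"
  have deg: "degree ?P = n" by simp
  obtain K where K: "K > 0" "\<And>z. K \<le> norm z \<Longrightarrow> norm (lead_coeff ?P) / 2 \<le> norm (poly ?P z / z ^ n)"
    "\<And>z. K \<le> norm z \<Longrightarrow> norm (poly ?P z / z ^ n) \<le> 2 * norm (lead_coeff ?P)"
    using poly_growth[of ?P] degP unfolding deg by blast
  define l where "l = norm (lead_coeff ?P)"
  have l: "l > 0" using degP deg unfolding l_def by (metis degree_0 less_irrefl norm_zero zero_less_norm_iff leading_coeff_0_iff)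
  have "bounded (poly ?P ` cball 0 K)"
    by (intro compact_imp_bounded compact_continuous_image continuous_intros) auto
  then obtain C where C0: "\<forall>y \<in> poly ?P ` cball 0 K. norm y \<le> C" unfolding bounded_iff by blast
  have C: "norm (poly ?P z) \<le> C" if "norm z \<le> K" for z using C0 that by auto
  \<comment> \<open>Beyond \<open>\<mu>\<close> the modulus of \<open>exp w\<close> exceeds the
    bound \<open>C\<close> for \<open>?P\<close> on the disc of radius \<open>K\<close>, so the
    branch lies outside that disc.\<close>
  define \<mu> where "\<mu> = max M (ln (\<bar>C\<bar> + 1))"
  let ?X = "{w. Re w > \<mu>}"
  have XB: "?X \<subseteq> B" by (auto simp: \<mu>_def B_def)
  have P_h: "poly ?P (h r w) = exp w" if "w \<in> B" for w
    using h(3)[OF r that] by (simp add: f_def)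
  have large: "K \<le> norm (h r w)" if w: "w \<in> ?X" for w
  proof (rule ccontr)
    assume "\<not> K \<le> norm (h r w)"
    then have "exp (Re w) \<le> C" using C[of "h r w"] P_h XB w by (auto simp: norm_exp_eq_Re)
    moreover have "ln (\<bar>C\<bar> + 1) < Re w" using w by (simp add: \<mu>_def)
    then have "exp (ln (\<bar>C\<bar> + 1)) < exp (Re w)" by (simp only: exp_less_cancel_iff)
    ultimately show False by simp
  qed
  have convX: "convex ?X" and openX: "open ?X" by (rule convex_halfspace_Re_gt open_halfspace_Re_gt)+
  have holX: "h r holomorphic_on ?X" by (rule holomorphic_on_subset[OF h(1)[OF r] XB])
  have nz: "h r w \<noteq> 0" if "w \<in> ?X" for w using large[OF that] K(1) by auto
  obtain g where g: "g holomorphic_on ?X" "\<And>w. w \<in> ?X \<Longrightarrow> h r w = exp (g w)"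
    by (rule simply_connected_imp_holomorphic_log[OF holX convex_imp_simply_connected[OF convX]
          open_imp_locally_path_connected[OF openX] nz]) auto
  obtain m :: int where m: "\<And>w. w \<in> ?X \<Longrightarrow> g (w + per k) = g w + \<i> * of_real (2 * pi * of_int m)"
  proof (rule exp_eq_imp_diff_const[of ?X "\<lambda>w. g (w + per k)" g])
    show "connected ?X" by (rule convex_connected[OF convX])
    show "continuous_on ?X (\<lambda>w. g (w + per k))"
      by (rule holomorphic_on_imp_continuous_on[OF hol_shift[OF g(1)]]) simp
    show "continuous_on ?X g" by (rule holomorphic_on_imp_continuous_on[OF g(1)])
    fix w assume w: "w \<in> ?X"
    then have "w + per k \<in> ?X" by simp
    then show "exp (g (w + per k)) = exp (g w)" using per[of w] w XB g(2) by (metis subsetD)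
  qed blast
  show ?thesis
  proof (cases "k = 0")
    case False
    \<comment> \<open>With \<open>w = - v\<close>, \<open>exp (u v)\<close> equals
      \<open>h r w ^ n / exp w\<close>, which is bounded above and away from zero because
      \<open>exp w = poly ?P (h r w)\<close>. The sign moves the right half-plane to the left one,
      and the increment of \<open>u\<close> compares \<open>k\<close> turns of \<open>w\<close> with
      \<open>n * m\<close> turns.\<close>
    define u where "u v = of_nat n * g (- v) + v" for v
    have "2 * pi * (real k - real n * of_int m) = 0"
    proof (rule shift_zero[of u "- \<mu>" "2 * pi * real k" _ "max \<bar>ln (1 / (2 * l))\<bar> \<bar>ln (2 / l)\<bar>"])
      have "(\<lambda>v. g (- v)) holomorphic_on {v. Re v < - \<mu>}"
      proof -
        have "(\<lambda>v :: complex. - v) holomorphic_on {v. Re v < - \<mu>}" by (intro holomorphic_intros)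
        moreover have "(\<lambda>v. - v) ` {v. Re v < - \<mu>} \<subseteq> ?X" by auto
        ultimately show ?thesis using holomorphic_on_compose_gen[OF _ g(1)] by (simp add: o_def)
      qed
      then show "u holomorphic_on {v. Re v < - \<mu>}" unfolding u_def by (intro holomorphic_intros)
      show "0 < 2 * pi * real k" using False by simp
      fix v assume v: "Re v < - \<mu>"
      have "g (- (v + per k) + per k) = g (- (v + per k)) + \<i> * of_real (2 * pi * of_int m)"
        by (rule m) (use v in simp)
      then have g': "g (- (v + per k)) = g (- v) - \<i> * of_real (2 * pi * of_int m)" by simp
      have "u (v + per k) = of_nat n * (g (- v) - \<i> * of_real (2 * pi * of_int m)) + (v + per k)"
        unfolding u_def g' ..
      then show "u (v + \<i> * of_real (2 * pi * real k)) = u v + \<i> * of_real (2 * pi * (real k - real n * of_int m))"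
        unfolding per_def u_def by (simp add: algebra_simps)
      define w where "w = - v"
      have w: "w \<in> ?X" using v by (simp add: w_def)
      have e: "exp (Re (u v)) = 1 / norm (poly ?P (h r w) / h r w ^ n)"
      proof -
        have "exp (Re (u v)) = norm (exp (u v))" by (simp add: norm_exp_eq_Re)
        also have "exp (u v) = h r w ^ n / exp w"
          using g(2)[OF w] by (simp add: u_def w_def exp_add exp_minus exp_of_nat_mult field_simps)
        also have "exp w = poly ?P (h r w)" using P_h XB w by (metis subsetD)
        finally show ?thesis by (simp add: norm_divide)
      qed
      let ?q = "norm (poly ?P (h r w) / h r w ^ n)"
      have q: "l / 2 \<le> ?q" "?q \<le> 2 * l" using K(2,3)[OF large[OF w]] by (simp_all add: l_def)
      have q0: "?q > 0" using q(1) l by linarith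
      have "1 / (2 * l) \<le> exp (Re (u v))" unfolding e
        by (rule divide_left_mono[OF q(2) _ mult_pos_pos[OF _ q0]]) (use l in simp_all)
      moreover have "exp (Re (u v)) \<le> 1 / (l / 2)" unfolding e
        by (rule divide_left_mono[OF q(1) _ mult_pos_pos[OF q0]]) (use l in simp_all)
      ultimately have "ln (1 / (2 * l)) \<le> Re (u v)" "Re (u v) \<le> ln (2 / l)"
        using l ln_le_cancel_iff[of "1 / (2 * l)" "exp (Re (u v))"] ln_le_cancel_iff[of "exp (Re (u v))" "2 / l"] by simp_all
      then show "\<bar>Re (u v)\<bar> \<le> max \<bar>ln (1 / (2 * l))\<bar> \<bar>ln (2 / l)\<bar>" by linarith
    qed
    then have "real_of_int (int k) = real_of_int (int n * m)" by simp
    then have "int k = int n * m" by (simp only: of_int_eq_iff)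
    then show ?thesis by simp
  qed simp
qed

text \<open>A coincidence after fewer than \<open>n\<close> further turns would be a positive period
  below \<open>n\<close>, against \<open>h_period\<close>; so the \<open>n\<close> values are
  distinct and fill the fibre.\<close>

lemma h_orbit:
  assumes r: "r \<in> Rts" and w: "w \<in> B"
  shows "(\<lambda>j. h r (w + per j)) ` {..<n} = {z. poly P z = f w}"
proof (rule card_seteq)
  have fw: "f w \<notin> bad" using f_notin w by blast
  show "finite {z. poly P z = f w}" by (rule fibre(1)[OF fw])
  show "(\<lambda>j. h r (w + per j)) ` {..<n} \<subseteq> {z. poly P z = f w}"
    using h(3)[OF r] w by auto
  have "False" if ij: "i < j" "j < n" "h r (w + per i) = h r (w + per j)" for i j
  proof -
    have "int n dvd int (j - i)"
    proof (rule h_period[OF r])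
      show "h r (v + per (j - i)) = h r v" if "v \<in> B" for v
        by (rule shift_coincide[of B "h r" w i]) (use h[OF r] ij w that in auto)
    qed
    then have "n dvd (j - i)" by simp
    then show False using ij by (meson dvd_imp_le less_imp_diff_less not_less zero_less_diff)
  qed
  then have "inj_on (\<lambda>j. h r (w + per j)) {..<n}"
    unfolding inj_on_def by (metis lessThan_iff linorder_neqE_nat)
  then show "card {z. poly P z = f w} \<le> card ((\<lambda>j. h r (w + per j)) ` {..<n})"
    using fibre(2)[OF fw] by (simp add: card_image)
qed

lemma Strip_B: "open (Strip \<inter> B)" "Strip \<inter> B \<noteq> {}" "Strip \<inter> B \<subseteq> D" "Strip \<inter> B \<subseteq> B"
  using open_Strip open_B w0_mem by (auto simp: D_def)

lemma hol_poly_lift [holomorphic_intros]: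
  assumes "r \<in> Rts"
  shows "(\<lambda>w. poly Q (p r w)) holomorphic_on D" "(\<lambda>w. poly Q (h r w)) holomorphic_on B"
  using p(1)[OF assms] h(1)[OF assms] by (auto intro!: holomorphic_intros)

text \<open>Continuing the relation around infinity makes it hold for every branch in place of
  \<open>s0\<close>. At a point where the modulus of \<open>Q\<close> is maximal on the fibre, strict
  convexity forces all terms of the mean to agree.\<close>

lemma branches_agree:
  assumes s0: "s0 \<in> Rts" and m: "\<And>r. r \<in> Rts \<Longrightarrow> m r \<ge> (0 :: real)"
    and rel: "\<And>w. w \<in> D \<Longrightarrow> of_real (\<Sum>r\<in>Rts. m r) * poly Q (p s0 w) = (\<Sum>r\<in>Rts. of_real (m r) * poly Q (p r w))"
    and s: "s \<in> Rts" "m s > 0" and w: "w \<in> D"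
  shows "poly Q (p s w) = poly Q (p s0 w)"
proof -
  have relB: "of_real (\<Sum>r\<in>Rts. m r) * poly Q (h s0 w) = (\<Sum>r\<in>Rts. of_real (m r) * poly Q (h r w))"
    if "w \<in> B" for w
  proof (rule analytic_continuation_open[OF Strip_B(1) open_B Strip_B(2) convex_connected[OF convex_B] Strip_B(4) _ _ _ that])
    fix v assume v: "v \<in> Strip \<inter> B"
    then have "v \<in> D" using Strip_B(3) by blast
    then show "of_real (\<Sum>r\<in>Rts. m r) * poly Q (h s0 v) = (\<Sum>r\<in>Rts. of_real (m r) * poly Q (h r v))"
      using rel[of v] p_eq_h[OF _ v] s0 by simp
  qed (intro holomorphic_intros s0; assumption)+
  define \<Delta> where "\<Delta> w = poly Q (h s w) - poly Q (h s0 w)" for w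
  have hol\<Delta>: "\<Delta> holomorphic_on B" unfolding \<Delta>_def by (intro holomorphic_intros s0 s)
  \<comment> \<open>The number of turns that leads to the largest modulus depends on
    \<open>w\<close>, so at first only the product over all translates is known to vanish. One
    factor must then vanish identically, and its translation can be undone.\<close>
  have "(\<Prod>j\<in>{..<n}. \<Delta> (w + per j)) = 0" if w: "w \<in> B" for w
  proof -
    let ?V = "(\<lambda>j. norm (poly Q (h s0 (w + per j)))) ` {..<n}"
    have "finite ?V" "?V \<noteq> {}" using degP by auto
    then have "Max ?V \<in> ?V" by (rule Max_in)
    then obtain j where j: "j < n" "Max ?V = norm (poly Q (h s0 (w + per j)))" by auto
    have max: "norm (poly Q z) \<le> norm (poly Q (h s0 (w + per j)))" if "poly P z = f w" for z
    proof -
      have "z \<in> (\<lambda>j. h s0 (w + per j)) ` {..<n}" using h_orbit[OF s0 w] that by blast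
      then have "norm (poly Q z) \<in> ?V" by blast
      then show ?thesis using Max_ge[OF \<open>finite ?V\<close>] j(2) by metis
    qed
    have wj: "w + per j \<in> B" using w by simp
    have "poly Q (h s (w + per j)) = poly Q (h s0 (w + per j))"
    proof (rule weighted_mean_extreme[OF fin_Rts m _ relB[OF wj] s])
      show "norm (poly Q (h r (w + per j))) \<le> norm (poly Q (h s0 (w + per j)))" if "r \<in> Rts" for r
        using h(3)[OF that wj] by (intro max) simp
    qed
    then have "\<Delta> (w + per j) = 0" by (simp add: \<Delta>_def)
    then show ?thesis using j(1) by auto
  qed
  then have "\<exists>j\<in>{..<n}. \<forall>w\<in>B. \<Delta> (w + per j) = 0"
    by (intro holomorphic_prod_eq_0 open_B convex_connected convex_B hol_shift hol\<Delta>)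
      (use w0_mem in auto)
  then obtain j where j: "\<And>w. w \<in> B \<Longrightarrow> \<Delta> (w + per j) = 0" by blast
  have zero: "\<Delta> w = 0" if "w \<in> B" for w
    using j[of "w - per j"] that by (simp add: B_def)
  show ?thesis
  proof (rule analytic_continuation_open[OF Strip_B(1) open_D Strip_B(2) conn_D Strip_B(3) _ _ _ w])
    fix v assume v: "v \<in> Strip \<inter> B"
    show "poly Q (p s v) = poly Q (p s0 v)"
      using zero[of v] v p_eq_h[OF s0 v] p_eq_h[OF s(1) v] by (simp add: \<Delta>_def)
  qed (intro holomorphic_intros s0 s)+
qed

text \<open>Far out in the strip, the principal logarithms differ from
  \<open>branch_log b r - branch_log a r\<close> by constants, so the relation extends
  holomorphically to \<open>D\<close>. Over \<open>E\<close>, a shift by \<open>per N\<close>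
  restores every \<open>p r\<close> and changes only the logarithms; subtracting the two relations
  leaves the winding numbers as coefficients.\<close>

lemma log_relation_shift:
  fixes Q \<Theta> :: "complex poly"
  assumes a: "poly P a \<in> bad" and b: "poly P b \<in> bad"
    and far: "\<And>t x. T < norm t \<Longrightarrow> poly P x = t \<Longrightarrow> norm (b - a) < norm (x - a)"
    and rel: "\<And>t. T < norm t \<Longrightarrow> rsquarefree (P - [:t:]) \<Longrightarrow>
      (\<Sum>x | poly P x = t. poly Q x * Ln ((b - x) / (a - x)) + poly \<Theta> x) = 0"
    and w: "w \<in> D"
  shows "(\<Sum>r\<in>Rts. of_int (winding a r) * poly Q (p r w)) = (\<Sum>r\<in>Rts. of_int (winding b r) * poly Q (p r w))"
proof -
  define \<mu> where "\<mu> = max M (ln (\<bar>T\<bar> + norm \<alpha> + 1))"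
  define X where "X = Strip \<inter> {w. Re w > \<mu>}"
  have XD: "X \<subseteq> D" by (auto simp: X_def D_def)
  have convX: "convex X" and openX: "open X"
    unfolding X_def by (intro convex_Int open_Int convex_Strip open_Strip convex_halfspace_Re_gt open_halfspace_Re_gt)+
  have "Complex (\<mu> + 1) \<theta> \<in> X" using \<delta> by (simp add: X_def Strip_def)
  then have X0: "X \<noteq> {}" by blast
  have big: "T < norm (f w)" if "w \<in> X" for w
  proof -
    have "exp (ln (\<bar>T\<bar> + norm \<alpha> + 1)) < exp (Re w)" using that by (auto simp: X_def \<mu>_def)
    then have "\<bar>T\<bar> + norm \<alpha> + 1 < norm (exp w)"
      by (subst (asm) exp_ln) (auto simp: norm_exp_eq_Re add_nonneg_pos)
    moreover have "norm (exp w) \<le> norm (f w) + norm \<alpha>"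
      using norm_triangle_ineq4[of "f w" \<alpha>] by (simp add: f_def)
    ultimately show ?thesis by linarith
  qed
  have "\<exists>k::int. \<forall>w\<in>X. Ln ((b - p r w) / (a - p r w)) = (branch_log b r w - branch_log a r w) + \<i> * of_real (2 * pi * of_int k)"
    if r: "r \<in> Rts" for r
  proof -
    have ineq: "norm (b - a) < norm (p r w - a)" if "w \<in> X" for w
      using far[OF big[OF that]] p(3)[OF r] that XD by blast
    have ne: "a - p r w \<noteq> 0" if "w \<in> X" for w using ineq[OF that] by auto
    have nn: "(b - p r w) / (a - p r w) \<notin> \<real>\<^sub>\<le>\<^sub>0" if "w \<in> X" for w
    proof -
      have "norm ((b - a) / (a - p r w)) < 1"
        using ineq[OF that] by (simp add: norm_divide norm_minus_commute divide_less_eq)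
      moreover have "(b - p r w) / (a - p r w) = 1 + (b - a) / (a - p r w)"
        using ne[OF that] by (simp add: field_simps)
      ultimately have "Re ((b - p r w) / (a - p r w)) > 0"
        using abs_Re_le_cmod[of "(b - a) / (a - p r w)"] by simp
      then show ?thesis by (auto simp: complex_nonpos_Reals_iff)
    qed
    have contp: "continuous_on X (p r)"
      by (rule continuous_on_subset[OF holomorphic_on_imp_continuous_on[OF p(1)[OF r]] XD])
    have contl: "continuous_on X (branch_log c r)" if "poly P c \<in> bad" for c
      by (rule continuous_on_subset[OF holomorphic_on_imp_continuous_on[OF branch_log(1)[OF r that]] XD])
    have 1: "continuous_on X (\<lambda>w. Ln ((b - p r w) / (a - p r w)))"
      by (intro continuous_intros contp) (use ne nn in auto)
    have 2: "continuous_on X (\<lambda>w. branch_log b r w - branch_log a r w)" by (intro continuous_intros contl a b)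
    have 3: "exp (Ln ((b - p r w) / (a - p r w))) = exp (branch_log b r w - branch_log a r w)" if w: "w \<in> X" for w
    proof -
      have "exp (branch_log b r w - branch_log a r w) = (p r w - b) / (p r w - a)"
        using branch_log(2)[OF r a] branch_log(2)[OF r b] w XD by (auto simp: exp_diff)
      also have "\<dots> = (b - p r w) / (a - p r w)" by (metis minus_diff_eq minus_divide_divide)
      finally show ?thesis using nn[OF w] by (subst exp_Ln) auto
    qed
    from exp_eq_imp_diff_const[OF convex_connected[OF convX] 1 2 3] show ?thesis by metis
  qed
  then obtain k :: "complex \<Rightarrow> int" where k: "\<And>r w. r \<in> Rts \<Longrightarrow> w \<in> X \<Longrightarrow>
      Ln ((b - p r w) / (a - p r w)) = (branch_log b r w - branch_log a r w) + \<i> * of_real (2 * pi * of_int (k r))"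
    by metis
  let ?G = "\<lambda>w. \<Sum>r\<in>Rts. poly Q (p r w) * ((branch_log b r w - branch_log a r w) + \<i> * of_real (2 * pi * of_int (k r))) + poly \<Theta> (p r w)"
  have G0: "?G w = 0" if "w \<in> D" for w
  proof (rule analytic_continuation_open[of X D ?G "\<lambda>_. 0"])
    show "?G holomorphic_on D" by (intro holomorphic_intros branch_log a b) 
    fix v assume v: "v \<in> X"
    then have vD: "v \<in> D" using XD by blast
    have "f v \<notin> bad" using f_notin vD by blast
    from rel[OF big[OF v] fibre(3)[OF this]]
    have "(\<Sum>r\<in>Rts. poly Q (p r v) * Ln ((b - p r v) / (a - p r v)) + poly \<Theta> (p r v)) = 0"
      unfolding fibre_sum[OF vD] .
    then show "?G v = 0" using k[OF _ v] by simp
  qed (use openX open_D X0 conn_D XD that in auto)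
  have onE: "(\<Sum>r\<in>Rts. of_int (winding a r) * poly Q (p r w)) = (\<Sum>r\<in>Rts. of_int (winding b r) * poly Q (p r w))"
    if w: "w \<in> E" for w
  proof -
    have "w \<in> D" "w + per N \<in> D" using w shift_mem(1)[of w N] by (auto simp: D_def)
    then have "?G (w + per N) - ?G w = 0" using G0 by simp
    moreover have "?G (w + per N) - ?G w = (\<Sum>r\<in>Rts. (\<i> * of_real (2 * pi)) * (of_int (winding b r) * poly Q (p r w) - of_int (winding a r) * poly Q (p r w)))"
      unfolding sum_subtractf[symmetric]
    proof (rule sum.cong)
      fix r assume r: "r \<in> Rts"
      show "poly Q (p r (w + per N)) * (branch_log b r (w + per N) - branch_log a r (w + per N) + \<i> * of_real (2 * pi * of_int (k r))) + poly \<Theta> (p r (w + per N))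
        - (poly Q (p r w) * (branch_log b r w - branch_log a r w + \<i> * of_real (2 * pi * of_int (k r))) + poly \<Theta> (p r w))
        = (\<i> * of_real (2 * pi)) * (of_int (winding b r) * poly Q (p r w) - of_int (winding a r) * poly Q (p r w))"
        unfolding p_period[OF r w] branch_log(3)[OF r a w] branch_log(3)[OF r b w] by (simp add: algebra_simps)
    qed simp
    ultimately have "(\<i> * of_real (2 * pi)) * (\<Sum>r\<in>Rts. of_int (winding b r) * poly Q (p r w) - of_int (winding a r) * poly Q (p r w)) = 0"
      by (simp only: sum_distrib_left)
    then have "(\<Sum>r\<in>Rts. of_int (winding b r) * poly Q (p r w) - of_int (winding a r) * poly Q (p r w)) = 0" by simp
    then show ?thesis by (simp add: sum_subtractf)
  qed
  have "E \<noteq> {}" "E \<subseteq> D"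
  proof -
    have "Complex (- M - 1) 0 \<in> E" by (simp add: E_def)
    then show "E \<noteq> {}" by blast
  qed (simp add: D_def)
  show ?thesis
    by (rule analytic_continuation_open[OF open_E open_D \<open>E \<noteq> {}\<close> conn_D \<open>E \<subseteq> D\<close> _ _ onE w])
      (intro holomorphic_intros; assumption)+
qed

end

section \<open>Equality of \<open>W\<close> at the two endpoints\<close>

lemma common_value_at_endpoints:
  fixes P Q :: "complex poly"
  assumes mom: "\<And>i. contour_integral (linepath a b) (\<lambda>z. poly P z ^ i * poly (pderiv Q) z) = 0"
    and Qa: "poly Q a = 0" and Qb: "poly Q b = 0" and Q0: "Q \<noteq> 0"
    and reg: "poly (pderiv P) a \<noteq> 0"
    and W: "finite S" "\<And>x y. x \<notin> S \<Longrightarrow> poly P x = poly P y \<Longrightarrow> poly Q x = poly Q y \<Longrightarrow> poly W x = poly W y"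
  shows "poly W a = poly W b"
proof -
  define \<alpha> where "\<alpha> = poly P a"
  have degP: "degree P > 0"
  proof (rule ccontr)
    assume "\<not> degree P > 0"
    then have "pderiv P = 0" by (simp add: pderiv_eq_0_iff)
    then show False using reg by simp
  qed
  \<comment> \<open>The values at \<open>a\<close> and \<open>b\<close> are included so that no
    branch meets these points and logarithms about both exist.\<close>
  define bad where "bad = poly P ` {z. poly (pderiv P) z = 0} \<union> {\<alpha>, poly P b}"
  have "pderiv P \<noteq> 0" using reg by auto
  then have fin: "finite bad" unfolding bad_def by (intro finite_UnI finite_imageI poly_roots_finite) auto
  have abad: "poly P a \<in> bad" and bbad: "poly P b \<in> bad" by (auto simp: bad_def \<alpha>_def)
  obtain \<theta> \<delta> M where "poly_branches P bad \<alpha> \<theta> \<delta> M"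
    using poly_branches_exist[OF degP fin] bad_def by blast
  then interpret poly_branches P bad \<alpha> \<theta> \<delta> M .
  obtain s0 where s0: "s0 \<in> Rts" "\<And>r. r \<in> Rts \<Longrightarrow> winding a r = (if r = s0 then int N else 0)"
    using winding_simple[OF abad _ reg] \<alpha>_def by metis
  obtain \<Theta> :: "complex poly" and T where far: "\<And>t x. T < norm t \<Longrightarrow> poly P x = t \<Longrightarrow> norm (b - a) < norm (x - a)"
    and rel: "\<And>t. T < norm t \<Longrightarrow> rsquarefree (P - [:t:]) \<Longrightarrow>
      (\<Sum>x | poly P x = t. poly Q x * Ln ((b - x) / (a - x)) + poly \<Theta> x) = 0"
    by (rule moments_log_relation[OF mom Qa Qb]) blast
  have main: "of_nat N * poly Q (p s0 w) = (\<Sum>r\<in>Rts. of_int (winding b r) * poly Q (p r w))" if w: "w \<in> D" for w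
  proof -
    have "(\<Sum>r\<in>Rts. of_int (winding a r) * poly Q (p r w)) = (\<Sum>r\<in>Rts. if r = s0 then of_nat N * poly Q (p s0 w) else 0)"
      using s0(2) by (intro sum.cong) auto
    also have "\<dots> = of_nat N * poly Q (p s0 w)" using s0(1) fin_Rts by simp
    finally show ?thesis using log_relation_shift[OF abad bbad far rel w] by simp
  qed
  \<comment> \<open>Along this sequence \<open>f (w k)\<close> tends to \<open>\<alpha>\<close>. The
    moduli of \<open>exp (w k)\<close> are distinct, so the values of \<open>p s0\<close> are
    distinct too and meet a finite set only finitely often.\<close>
  define w where "w k = Complex (- M - 1 - real k) 0" for k
  have wE: "w k \<in> E" for k by (simp add: w_def E_def)
  then have wD: "w k \<in> D" for k by (simp add: D_def)
  have inj: "inj (\<lambda>k. p s0 (w k))"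
  proof (rule injI)
    fix i j assume "p s0 (w i) = p s0 (w j)"
    then have "f (w i) = f (w j)" using p(3)[OF s0(1)] wD by metis
    then have "norm (exp (w i)) = norm (exp (w j))" by (simp add: f_def)
    then show "i = j" by (simp add: norm_exp_eq_Re w_def)
  qed
  \<comment> \<open>Otherwise the windings about \<open>b\<close> are non-negative with sum zero,
    hence all zero, and \<open>main\<close> gives \<open>Q\<close> infinitely many zeros.\<close>
  have Pb: "poly P b = \<alpha>"
  proof (rule ccontr)
    assume "poly P b \<noteq> \<alpha>"
    then have "(\<Sum>r\<in>Rts. winding b r) = 0" using winding_sum[OF bbad] by simp
    then have "\<forall>r\<in>Rts. winding b r = 0"
      using sum_nonneg_eq_0_iff[OF fin_Rts] winding_nonneg[OF _ bbad] by blast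
    then have "poly Q (p s0 (w k)) = 0" for k using main[OF wD[of k]] N_pos by simp
    then have "range (\<lambda>k. p s0 (w k)) \<subseteq> {z. poly Q z = 0}" by auto
    then have "finite (range (\<lambda>k. p s0 (w k)))" using poly_roots_finite[OF Q0] finite_subset by blast
    then show False using inj finite_imageD by blast
  qed
  have sumb: "(\<Sum>r\<in>Rts. winding b r) = int N" using winding_sum[OF bbad] Pb by simp
  obtain s where s: "s \<in> Rts" "winding b s > 0"
  proof (rule ccontr)
    assume "\<not> thesis"
    then have "\<forall>r\<in>Rts. winding b r = 0" using that winding_nonneg[OF _ bbad] by force
    then show False using sumb N_pos by simp
  qed
  have agree: "poly Q (p s v) = poly Q (p s0 v)" if "v \<in> D" for v
  proof (rule branches_agree[OF s0(1) _ _ s(1) _ that, of "\<lambda>r. real_of_int (winding b r)"])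
    show "of_real (\<Sum>r\<in>Rts. real_of_int (winding b r)) * poly Q (p s0 w)
      = (\<Sum>r\<in>Rts. of_real (real_of_int (winding b r)) * poly Q (p r w))" if "w \<in> D" for w
    proof -
      have "(\<Sum>r\<in>Rts. real_of_int (winding b r)) = real N" using sumb by (metis of_int_of_nat_eq of_int_sum)
      then show ?thesis using main[OF that] by simp
    qed
  qed (use winding_nonneg[OF _ bbad] s in auto)
  have lim: "(\<lambda>k. p r (w k)) \<longlonglongrightarrow> c" if rc: "r \<in> Rts" "poly P c \<in> bad" "poly P c = \<alpha>" "winding c r > 0" for r c
  proof (rule LIMSEQ_I)
    fix \<epsilon> :: real assume "\<epsilon> > 0"
    then obtain \<mu> where \<mu>: "\<And>v. Re v < - \<mu> \<Longrightarrow> norm (p r v - c) < \<epsilon>"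
      using winding_limit[OF rc] by blast
    obtain k0 :: nat where "\<mu> < real k0" using reals_Archimedean2 by blast
    then show "\<exists>k0. \<forall>k\<ge>k0. norm (p r (w k) - c) < \<epsilon>"
      using M by (intro exI[of _ k0] allI impI \<mu>) (simp add: w_def)
  qed
  have lim0: "(\<lambda>k. p s0 (w k)) \<longlonglongrightarrow> a"
    by (rule lim[OF s0(1) abad]) (use s0 N_pos in \<open>simp_all add: \<alpha>_def\<close>)
  have lim1: "(\<lambda>k. p s (w k)) \<longlonglongrightarrow> b" by (rule lim[OF s(1) bbad Pb s(2)])
  have "finite {k. p s0 (w k) \<in> S}"
    using finite_vimageI[OF W(1) inj] by (simp add: vimage_def)
  then have "\<forall>\<^sub>F k in cofinite. p s0 (w k) \<notin> S" unfolding eventually_cofinite by simp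
  then have ev: "\<forall>\<^sub>F k in sequentially. p s0 (w k) \<notin> S" unfolding cofinite_eq_sequentially .
  have ev': "\<forall>\<^sub>F k in sequentially. poly W (p s0 (w k)) = poly W (p s (w k))"
    using ev
  proof eventually_elim
    case (elim k)
    then show ?case
      by (rule W(2)) (use agree[OF wD] p(3)[OF s0(1) wD] p(3)[OF s(1) wD] in simp_all)
  qed
  show ?thesis
    by (rule LIMSEQ_unique[OF Lim_transform_eventually[OF tendsto_poly[OF lim0] ev'] tendsto_poly[OF lim1]])
qed

text \<open>\<open>Q\<close> is normalised to vanish at \<open>a\<close>; the moment of index 0 then
  makes it vanish at \<open>b\<close> as well. The subtracted constant is put back into the outer
  factor.\<close>

lemma moments_imp_common_factor:
  fixes P Q :: "complex poly"
  assumes mom: "\<And>i. contour_integral (linepath a b) (\<lambda>z. poly P z ^ i * poly (pderiv Q) z) = 0"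
    and Q: "pderiv Q \<noteq> 0" and reg: "poly (pderiv P) a \<noteq> 0"
  shows "\<exists>Pt Qt W :: complex poly. P = pcompose Pt W \<and> Q = pcompose Qt W \<and> poly W a = poly W b"
proof -
  have degP: "degree P > 0"
  proof (rule ccontr)
    assume "\<not> degree P > 0"
    then have "pderiv P = 0" by (simp add: pderiv_eq_0_iff)
    then show False using reg by simp
  qed
  define Q0 where "Q0 = Q - [:poly Q a:]"
  have dQ: "pderiv Q0 = pderiv Q" by (simp add: Q0_def pderiv_diff pderiv_pCons)
  have "poly Q b - poly Q a = 0"
    using contour_integral_unique[OF has_contour_integral_poly_deriv[of Q b a]] mom[of 0] by simp
  then have Q0b: "poly Q0 b = 0" and Q0a: "poly Q0 a = 0" by (simp_all add: Q0_def)
  have Q00: "Q0 \<noteq> 0" using Q dQ by auto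
  obtain W Pt Qt S where W: "P = pcompose Pt W" "Q0 = pcompose Qt W" "finite S"
    "\<And>x y. x \<notin> S \<Longrightarrow> poly P x = poly P y \<Longrightarrow> poly Q0 x = poly Q0 y \<Longrightarrow> poly W x = poly W y"
    by (rule common_right_factor[OF degP, of Q0]) blast
  have "poly W a = poly W b"
    by (rule common_value_at_endpoints[OF _ Q0a Q0b Q00 reg W(3,4)]) (use mom dQ in auto)
  moreover have "Q = pcompose (Qt + [:poly Q a:]) W"
    by (simp add: pcompose_add W(2)[symmetric] Q0_def)
  ultimately show ?thesis using W(1) by blast
qed

section \<open>Primitives of polynomials and the equivalence\<close>

lemma pderiv_sum: "pderiv (sum F A) = (\<Sum>x\<in>A. pderiv (F x))"
  using higher_pderiv_sum[of 1 F A] by simp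

lemma pderiv_surj:
  fixes G :: "'a :: field_char_0 poly"
  obtains F where "pderiv F = G"
proof
  show "pderiv (\<Sum>i\<le>degree G. monom (coeff G i / of_nat (Suc i)) (Suc i)) = G"
    by (simp add: pderiv_sum pderiv_monom poly_as_sum_of_monoms del: of_nat_Suc)
qed

theorem theorem5p1:
  fixes P q Q :: "complex poly" and a b :: complex
  assumes "q \<noteq> 0"
    and "a \<noteq> b"
    and "pderiv Q = q"
    and "poly (pderiv P) a \<noteq> 0 \<or> poly (pderiv P) b \<noteq> 0"
  shows "(\<forall>i::nat. contour_integral (linepath a b) (\<lambda>z. poly P z ^ i * poly q z) = 0)
    \<longleftrightarrow> (\<exists>Pt Qt W :: complex poly.
          P = pcompose Pt W \<and> Q = pcompose Qt W \<and> poly W a = poly W b)"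
proof
  assume mom: "\<forall>i::nat. contour_integral (linepath a b) (\<lambda>z. poly P z ^ i * poly q z) = 0"
  show "\<exists>Pt Qt W :: complex poly. P = pcompose Pt W \<and> Q = pcompose Qt W \<and> poly W a = poly W b"
  proof (cases "poly (pderiv P) a = 0")
    case False
    then show ?thesis using moments_imp_common_factor[of a b P Q] mom assms by auto
  next
    case True
    then have "poly (pderiv P) b \<noteq> 0" using assms(4) by simp
    \<comment> \<open>Reversing the path exchanges the roles of \<open>a\<close> and
      \<open>b\<close>.\<close>
    moreover have "contour_integral (linepath b a) (\<lambda>z. poly P z ^ i * poly (pderiv Q) z) = 0" for i
    proof -
      have "contour_integral (reversepath (linepath a b)) (\<lambda>z. poly P z ^ i * poly (pderiv Q) z) = 0"
        using mom assms(3) by (subst contour_integral_reversepath) auto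
      then show ?thesis by simp
    qed
    ultimately obtain Pt Qt W where "P = pcompose Pt W" "Q = pcompose Qt W" "poly W b = poly W a"
      using moments_imp_common_factor[of b a P Q] assms by auto
    then show ?thesis by metis
  qed
next
  assume "\<exists>Pt Qt W :: complex poly. P = pcompose Pt W \<and> Q = pcompose Qt W \<and> poly W a = poly W b"
  then obtain Pt Qt W where W: "P = pcompose Pt W" "Q = pcompose Qt W" "poly W a = poly W b" by blast
  show "\<forall>i::nat. contour_integral (linepath a b) (\<lambda>z. poly P z ^ i * poly q z) = 0"
  proof
    fix i
    \<comment> \<open>By the chain rule \<open>pcompose F W\<close> is a primitive of
      \<open>P ^ i * q\<close>, and it takes the same value at \<open>a\<close> and \<open>b\<close>
      because \<open>W\<close> does.\<close>
    obtain F :: "complex poly" where F: "pderiv F = Pt ^ i * pderiv Qt"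
      using pderiv_surj by metis
    have "(poly (pderiv (pcompose F W)) has_contour_integral poly (pcompose F W) b - poly (pcompose F W) a) (linepath a b)"
      by (rule has_contour_integral_poly_deriv)
    moreover have "poly (pderiv (pcompose F W)) = (\<lambda>z. poly P z ^ i * poly q z)"
      unfolding assms(3)[symmetric] W(1,2) by (rule ext) (simp add: pderiv_pcompose F poly_pcompose mult.assoc)
    ultimately have "((\<lambda>z. poly P z ^ i * poly q z) has_contour_integral 0) (linepath a b)"
      using W(3) by (simp add: poly_pcompose)
    then show "contour_integral (linepath a b) (\<lambda>z. poly P z ^ i * poly q z) = 0"
      by (rule contour_integral_unique)
  qed
qed

end
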